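(* Let $\mathcal{Q}$ be a small quantaloid. A KZ-doctrine $(\mathcal{T},\mu,\eta)$ on $\mathrm{Cat}(\mathcal{Q})$ is a full sub-KZ-doctrine of the free cocompletion KZ-doctrine $\mathcal{P}$ if and only if, for all $\mathcal{Q}$-categories $\mathbb{A}$, both $\eta_{\mathbb{A}}:\mathbb{A}\to\mathcal{T}(\mathbb{A})$ and the left Kan extension $\langle Y_{\mathbb{A}},\eta_{\mathbb{A}}\rangle:\mathcal{T}(\mathbb{A})\to\mathcal{P}(\mathbb{A})$ of the Yoneda embedding $Y_{\mathbb{A}}$ through $\eta_{\mathbb{A}}$ are fully faithful.
   Context: A quantaloid is a category whose hom-sets are complete lattices and whose composition preserves arbitrary suprema in each variable. $\mathcal{Q}$ is a small quantaloid, with set of objects $\mathcal{Q}_0$. A $\mathcal{Q}$-category $\mathbb{A}$ is a set $\mathbb{A}_0$ with a type function $t:\mathbb{A}_0\to\mathcal{Q}_0$ and $\mathcal{Q}$-arrows $\mathbb{A}(a',a):ta\to ta'$ with $1_{ta}\le\mathbb{A}(a,a)$ and $\mathbb{A}(a'',a')\circ\mathbb{A}(a',a)\le\mathbb{A}(a'',a)$. A functor $F:\mathbb{A}\to\mathbb{B}$ is a type-preserving map with $\mathbb{A}(a',a)\le\mathbb{B}(Fa',Fa)$; it is fully faithful if equality always holds. A distributor $\Phi$ from $\mathbb{A}$ to $\mathbb{B}$ is a matrix of arrows $\Phi(b,a):ta\to tb$ with $\Phi(b,a')\circ\mathbb{A}(a',a)\le\Phi(b,a)$ and $\mathbb{B}(b,b')\circ\Phi(b',a)\le\Phi(b,a)$.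 Composition is $(\Psi\otimes\Phi)(c,a)=\bigvee_b\Psi(c,b)\circ\Phi(b,a)$, the identity on $\mathbb{A}$ is the hom-matrix of $\mathbb{A}$, and distributors are ordered elementwise; this gives a (large) quantaloid $\mathrm{Dist}(\mathcal{Q})$. For $\Phi:\mathbb{A}\to\mathbb{C}$ and $\Psi:\mathbb{B}\to\mathbb{C}$ in $\mathrm{Dist}(\mathcal{Q})$, the lifting $[\Psi,\Phi]:\mathbb{A}\to\mathbb{B}$ is the largest distributor with $\Psi\otimes[\Psi,\Phi]\le\Phi$. A functor $F:\mathbb{A}\to\mathbb{B}$ gives a distributor $\mathbb{B}(-,F-):\mathbb{A}\to\mathbb{B}$. Parallel functors are preordered by $F\le G$ iff $\mathbb{B}(-,F-)\le\mathbb{B}(-,G-)$, and $F\cong G$ means $F\le G\le F$; this makes $\mathrm{Cat}(\mathcal{Q})$ a locally (pre)ordered 2-category. Since local orders are only preorders, equations between functors (naturality, factorisations, monad laws) are understood up to $\cong$. $*_X$ is the one-object $\mathcal{Q}$-category with object of type $X$ and hom-arrow $1_X$. A presheaf on $\mathbb{A}$ is a distributor $\phi:*_X\to\mathbb{A}$, $X\in\mathcal{Q}_0$. Presheaves on $\mathbb{A}$ are the objects of the $\mathcal{Q}$-category $\mathcal{P}(\mathbb{A})$, with $t\phi=X$ and $\mathcal{P}(\mathbb{A})(\psi,\phi)=$ the single element of $[\psi,\phi]$. The Yoneda embedding is $Y_{\mathbb{A}}:\mathbb{A}\to\mathcal{P}(\mathbb{A}):a\mapsto\mathbb{A}(-,a)$.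 $\mathcal{P}$ is a 2-functor on $\mathrm{Cat}(\mathcal{Q})$ via $\mathcal{P}(F)(\phi)=\mathbb{B}(-,F-)\otimes\phi$, and a 2-monad with unit $Y$ and multiplication $M_{\mathbb{A}}:\mathcal{P}(\mathcal{P}(\mathbb{A}))\to\mathcal{P}(\mathbb{A})$, $M_{\mathbb{A}}(\Theta)(a)=\bigvee_{\phi\in\mathcal{P}(\mathbb{A})}\phi(a)\circ\Theta(\phi)$. Left Kan extension: given $F:\mathbb{A}\to\mathbb{B}$ and $G:\mathbb{A}\to\mathbb{C}$, $\langle F,G\rangle:\mathbb{C}\to\mathbb{B}$ is the smallest functor $K$ with $F\le K\circ G$. For $F=Y_{\mathbb{A}}$ and $G=\eta_{\mathbb{A}}$ it exists and is given by $t\mapsto\mathcal{T}(\mathbb{A})(\eta_{\mathbb{A}}-,t)$. A KZ-doctrine on a locally ordered 2-category $\mathcal{K}$ is a 2-monad $(\mathcal{T},\mu,\eta)$ on $\mathcal{K}$ with $\mathcal{T}(\eta_K)\le\eta_{\mathcal{T}(K)}$ for all objects $K$. $\mathcal{P}$ is a KZ-doctrine (the free cocompletion KZ-doctrine). A KZ-doctrine $(\mathcal{T},\mu,\eta)$ on $\mathrm{Cat}(\mathcal{Q})$ is a full sub-KZ-doctrine of $\mathcal{P}$ if there is a 2-natural transformation $\varepsilon:\mathcal{T}\Rightarrow\mathcal{P}$ with all components fully faithful functors, such that $M\circ(\varepsilon*\varepsilon)=\varepsilon\circ\mu$ and $Y=\varepsilon\circ\eta$, where $(\varepsilon*\varepsilon)_{\mathbb{A}}=\mathcal{P}(\varepsilon_{\mathbb{A}})\circ\varepsilon_{\mathcal{T}(\mathbb{A})}$.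 *)

theory Defs
  imports "HOL-Algebra.Complete_Lattice" "HOL-Library.FuncSet" "HOL-Library.Equipollence"
begin

section \<open>Quantaloids\<close>

record ('o, 'm) quantaloid =
  obj :: "'o set"
  arr :: "'m set"
  src :: "'m \<Rightarrow> 'o"
  tgt :: "'m \<Rightarrow> 'o"
  unt :: "'o \<Rightarrow> 'm"
  cmp :: "'m \<Rightarrow> 'm \<Rightarrow> 'm" (infixl \<open>\<cdot>\<index>\<close> 70)
  leq :: "'m \<Rightarrow> 'm \<Rightarrow> bool" (infix \<open>\<preceq>\<index>\<close> 50)

definition hom :: "('o, 'm) quantaloid \<Rightarrow> 'o \<Rightarrow> 'o \<Rightarrow> 'm set" where
  "hom Q X Y = {f \<in> arr Q. src Q f = X \<and> tgt Q f = Y}"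

definition homlat :: "('o, 'm) quantaloid \<Rightarrow> 'o \<Rightarrow> 'o \<Rightarrow> 'm gorder" where
  "homlat Q X Y = \<lparr>carrier = hom Q X Y, eq = (=), le = leq Q\<rparr>"

text \<open>Suprema are indexed by the hom-set in which they are taken, as the supremum of the
  empty set depends on it.\<close>

abbreviation homSup :: "('o, 'm) quantaloid \<Rightarrow> 'o \<Rightarrow> 'o \<Rightarrow> 'm set \<Rightarrow> 'm" where
  "homSup Q X Y S \<equiv> \<Squnion>\<^bsub>homlat Q X Y\<^esub>S"

locale quantaloid =
  fixes Q :: "('o, 'm) quantaloid" (structure)
  assumes src_obj: "f \<in> arr Q \<Longrightarrow> src Q f \<in> obj Q"
    and tgt_obj: "f \<in> arr Q \<Longrightarrow> tgt Q f \<in> obj Q"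
    and unt_hom: "X \<in> obj Q \<Longrightarrow> unt Q X \<in> hom Q X X"
    and cmp_hom: "\<lbrakk>f \<in> hom Q X Y; g \<in> hom Q Y Z\<rbrakk> \<Longrightarrow> g \<cdot> f \<in> hom Q X Z"
    and cmp_unt: "f \<in> hom Q X Y \<Longrightarrow> f \<cdot> unt Q X = f"
    and unt_cmp: "f \<in> hom Q X Y \<Longrightarrow> unt Q Y \<cdot> f = f"
    and cmp_assoc: "\<lbrakk>f \<in> hom Q W X; g \<in> hom Q X Y; h \<in> hom Q Y Z\<rbrakk> \<Longrightarrow> (h \<cdot> g) \<cdot> f = h \<cdot> (g \<cdot> f)"
    and complete_homlat: "\<lbrakk>X \<in> obj Q; Y \<in> obj Q\<rbrakk> \<Longrightarrow> complete_lattice (homlat Q X Y)"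
    and cmp_Sup: "\<lbrakk>X \<in> obj Q; S \<subseteq> hom Q X Y; g \<in> hom Q Y Z\<rbrakk>
      \<Longrightarrow> g \<cdot> homSup Q X Y S = homSup Q X Z ((\<lambda>f. g \<cdot> f) ` S)"
    and Sup_cmp: "\<lbrakk>Z \<in> obj Q; f \<in> hom Q X Y; S \<subseteq> hom Q Y Z\<rbrakk>
      \<Longrightarrow> homSup Q Y Z S \<cdot> f = homSup Q X Z ((\<lambda>g. g \<cdot> f) ` S)"


section \<open>Categories, functors and distributors enriched in a quantaloid\<close>

text \<open>The arrow \<open>hm A a' a\<close> goes from the type of \<open>a\<close> to the type of \<open>a'\<close>. Values of
  \<open>ty\<close>, \<open>hm\<close>, of functors and of distributors outside the object sets are irrelevant.\<close>

record ('u, 'o, 'm) qcat =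
  ob :: "'u set"
  ty :: "'u \<Rightarrow> 'o"
  hm :: "'u \<Rightarrow> 'u \<Rightarrow> 'm"

definition qcategory :: "('o, 'm) quantaloid \<Rightarrow> ('u, 'o, 'm) qcat \<Rightarrow> bool" where
  "qcategory Q A \<longleftrightarrow>
     (\<forall>a\<in>ob A. ty A a \<in> obj Q) \<and>
     (\<forall>a\<in>ob A. \<forall>a'\<in>ob A. hm A a' a \<in> hom Q (ty A a) (ty A a')) \<and>
     (\<forall>a\<in>ob A. unt Q (ty A a) \<preceq>\<^bsub>Q\<^esub> hm A a a) \<and>
     (\<forall>a\<in>ob A. \<forall>a'\<in>ob A. \<forall>a''\<in>ob A. hm A a'' a' \<cdot>\<^bsub>Q\<^esub> hm A a' a \<preceq>\<^bsub>Q\<^esub> hm A a'' a)"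

definition qfunctor ::
  "('o, 'm) quantaloid \<Rightarrow> ('u, 'o, 'm) qcat \<Rightarrow> ('v, 'o, 'm) qcat \<Rightarrow> ('u \<Rightarrow> 'v) \<Rightarrow> bool" where
  "qfunctor Q A B F \<longleftrightarrow>
     F \<in> ob A \<rightarrow> ob B \<and>
     (\<forall>a\<in>ob A. ty B (F a) = ty A a) \<and>
     (\<forall>a\<in>ob A. \<forall>a'\<in>ob A. hm A a' a \<preceq>\<^bsub>Q\<^esub> hm B (F a') (F a))"

definition fully_faithful ::
  "('o, 'm) quantaloid \<Rightarrow> ('u, 'o, 'm) qcat \<Rightarrow> ('v, 'o, 'm) qcat \<Rightarrow> ('u \<Rightarrow> 'v) \<Rightarrow> bool" where
  "fully_faithful Q A B F \<longleftrightarrow>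
     qfunctor Q A B F \<and> (\<forall>a\<in>ob A. \<forall>a'\<in>ob A. hm A a' a = hm B (F a') (F a))"

text \<open>A distributor from \<open>A\<close> to \<open>B\<close> is a matrix with rows in \<open>B\<close> and columns in \<open>A\<close>.\<close>

definition distributor ::
  "('o, 'm) quantaloid \<Rightarrow> ('u, 'o, 'm) qcat \<Rightarrow> ('v, 'o, 'm) qcat \<Rightarrow> ('v \<Rightarrow> 'u \<Rightarrow> 'm) \<Rightarrow> bool" where
  "distributor Q A B \<Phi> \<longleftrightarrow>
     (\<forall>a\<in>ob A. \<forall>b\<in>ob B. \<Phi> b a \<in> hom Q (ty A a) (ty B b)) \<and>
     (\<forall>a\<in>ob A. \<forall>a'\<in>ob A. \<forall>b\<in>ob B. \<Phi> b a' \<cdot>\<^bsub>Q\<^esub> hm A a' a \<preceq>\<^bsub>Q\<^esub> \<Phi> b a) \<and>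
     (\<forall>a\<in>ob A. \<forall>b\<in>ob B. \<forall>b'\<in>ob B. hm B b b' \<cdot>\<^bsub>Q\<^esub> \<Phi> b' a \<preceq>\<^bsub>Q\<^esub> \<Phi> b a)"

definition dist_le ::
  "('o, 'm) quantaloid \<Rightarrow> ('u, 'o, 'm) qcat \<Rightarrow> ('v, 'o, 'm) qcat
    \<Rightarrow> ('v \<Rightarrow> 'u \<Rightarrow> 'm) \<Rightarrow> ('v \<Rightarrow> 'u \<Rightarrow> 'm) \<Rightarrow> bool" where
  "dist_le Q A B \<Phi> \<Psi> \<longleftrightarrow> (\<forall>a\<in>ob A. \<forall>b\<in>ob B. \<Phi> b a \<preceq>\<^bsub>Q\<^esub> \<Psi> b a)"

definition dist_comp ::
  "('o, 'm) quantaloid \<Rightarrow> ('u, 'o, 'm) qcat \<Rightarrow> ('v, 'o, 'm) qcat \<Rightarrow> ('w, 'o, 'm) qcat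
    \<Rightarrow> ('w \<Rightarrow> 'v \<Rightarrow> 'm) \<Rightarrow> ('v \<Rightarrow> 'u \<Rightarrow> 'm) \<Rightarrow> 'w \<Rightarrow> 'u \<Rightarrow> 'm" where
  "dist_comp Q A B C \<Psi> \<Phi> c a =
     homSup Q (ty A a) (ty C c) ((\<lambda>b. \<Psi> c b \<cdot>\<^bsub>Q\<^esub> \<Phi> b a) ` ob B)"

definition is_lifting ::
  "('o, 'm) quantaloid \<Rightarrow> ('u, 'o, 'm) qcat \<Rightarrow> ('v, 'o, 'm) qcat \<Rightarrow> ('w, 'o, 'm) qcat
    \<Rightarrow> ('w \<Rightarrow> 'v \<Rightarrow> 'm) \<Rightarrow> ('w \<Rightarrow> 'u \<Rightarrow> 'm) \<Rightarrow> ('v \<Rightarrow> 'u \<Rightarrow> 'm) \<Rightarrow> bool" where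
  "is_lifting Q A B C \<Psi> \<Phi> \<Theta> \<longleftrightarrow>
     distributor Q A B \<Theta> \<and> dist_le Q A C (dist_comp Q A B C \<Psi> \<Theta>) \<Phi> \<and>
     (\<forall>\<Theta>'. distributor Q A B \<Theta>' \<and> dist_le Q A C (dist_comp Q A B C \<Psi> \<Theta>') \<Phi>
        \<longrightarrow> dist_le Q A B \<Theta>' \<Theta>)"

text \<open>The entries of a lifting at objects of \<open>A\<close> and \<open>B\<close> are uniquely determined, so the
  choice concerns irrelevant values only.\<close>

definition lifting ::
  "('o, 'm) quantaloid \<Rightarrow> ('u, 'o, 'm) qcat \<Rightarrow> ('v, 'o, 'm) qcat \<Rightarrow> ('w, 'o, 'm) qcat
    \<Rightarrow> ('w \<Rightarrow> 'v \<Rightarrow> 'm) \<Rightarrow> ('w \<Rightarrow> 'u \<Rightarrow> 'm) \<Rightarrow> 'v \<Rightarrow> 'u \<Rightarrow> 'm" where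
  "lifting Q A B C \<Psi> \<Phi> = (SOME \<Theta>. is_lifting Q A B C \<Psi> \<Phi> \<Theta>)"

text \<open>The distributor \<open>B(-,F-)\<close>.\<close>

definition fdist :: "('v, 'o, 'm) qcat \<Rightarrow> ('u \<Rightarrow> 'v) \<Rightarrow> 'v \<Rightarrow> 'u \<Rightarrow> 'm" where
  "fdist B F = (\<lambda>b a. hm B b (F a))"

definition fun_le ::
  "('o, 'm) quantaloid \<Rightarrow> ('u, 'o, 'm) qcat \<Rightarrow> ('v, 'o, 'm) qcat
    \<Rightarrow> ('u \<Rightarrow> 'v) \<Rightarrow> ('u \<Rightarrow> 'v) \<Rightarrow> bool" where
  "fun_le Q A B F G \<longleftrightarrow> dist_le Q A B (fdist B F) (fdist B G)"

definition fun_iso ::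
  "('o, 'm) quantaloid \<Rightarrow> ('u, 'o, 'm) qcat \<Rightarrow> ('v, 'o, 'm) qcat
    \<Rightarrow> ('u \<Rightarrow> 'v) \<Rightarrow> ('u \<Rightarrow> 'v) \<Rightarrow> bool" where
  "fun_iso Q A B F G \<longleftrightarrow> fun_le Q A B F G \<and> fun_le Q A B G F"

text \<open>\<open>is_lan Q A B C F G K\<close>: for \<open>F\<close> from \<open>A\<close> to \<open>B\<close> and \<open>G\<close> from \<open>A\<close> to \<open>C\<close>, the functor \<open>K\<close>
  from \<open>C\<close> to \<open>B\<close> is the left Kan extension \<open>\<langle>F,G\<rangle>\<close>, which is unique up to \<open>fun_iso\<close>.\<close>

definition is_lan ::
  "('o, 'm) quantaloid \<Rightarrow> ('u, 'o, 'm) qcat \<Rightarrow> ('v, 'o, 'm) qcat \<Rightarrow> ('w, 'o, 'm) qcat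
    \<Rightarrow> ('u \<Rightarrow> 'v) \<Rightarrow> ('u \<Rightarrow> 'w) \<Rightarrow> ('w \<Rightarrow> 'v) \<Rightarrow> bool" where
  "is_lan Q A B C F G K \<longleftrightarrow>
     qfunctor Q C B K \<and> fun_le Q A B F (K \<circ> G) \<and>
     (\<forall>K'. qfunctor Q C B K' \<and> fun_le Q A B F (K' \<circ> G) \<longrightarrow> fun_le Q C B K K')"


section \<open>Presheaves and the free cocompletion\<close>

definition star :: "('o, 'm) quantaloid \<Rightarrow> 'o \<Rightarrow> (unit, 'o, 'm) qcat" where
  "star Q X = \<lparr>ob = {()}, ty = (\<lambda>_. X), hm = (\<lambda>_ _. unt Q X)\<rparr>"

text \<open>A presheaf of type \<open>X\<close> is the pair of \<open>X\<close> and the single column of a distributor from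
  \<open>star Q X\<close>; the column is required to be extensional, so that distinct elements of the object set
  are distinct presheaves.\<close>

type_synonym ('u, 'o, 'm) presheaf = "'o \<times> ('u \<Rightarrow> 'm)"

definition col :: "('u, 'o, 'm) presheaf \<Rightarrow> 'u \<Rightarrow> unit \<Rightarrow> 'm" where
  "col \<phi> = (\<lambda>a _. snd \<phi> a)"

definition Psh ::
  "('o, 'm) quantaloid \<Rightarrow> ('u, 'o, 'm) qcat \<Rightarrow> (('u, 'o, 'm) presheaf, 'o, 'm) qcat" where
  "Psh Q A =
     \<lparr>ob = {\<phi>. fst \<phi> \<in> obj Q \<and> snd \<phi> \<in> extensional (ob A)
              \<and> distributor Q (star Q (fst \<phi>)) A (col \<phi>)},
      ty = fst,
      hm = (\<lambda>\<psi> \<phi>. lifting Q (star Q (fst \<phi>)) (star Q (fst \<psi>)) A (col \<psi>) (col \<phi>) () ())\<rparr>"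

definition yoneda :: "('u, 'o, 'm) qcat \<Rightarrow> 'u \<Rightarrow> ('u, 'o, 'm) presheaf" where
  "yoneda A a = (ty A a, \<lambda>a'\<in>ob A. hm A a' a)"

definition Psh_map ::
  "('o, 'm) quantaloid \<Rightarrow> ('u, 'o, 'm) qcat \<Rightarrow> ('v, 'o, 'm) qcat \<Rightarrow> ('u \<Rightarrow> 'v)
    \<Rightarrow> ('u, 'o, 'm) presheaf \<Rightarrow> ('v, 'o, 'm) presheaf" where
  "Psh_map Q A B F \<phi> =
     (fst \<phi>, \<lambda>b\<in>ob B. dist_comp Q (star Q (fst \<phi>)) A B (fdist B F) (col \<phi>) b ())"

definition Psh_mult ::
  "('o, 'm) quantaloid \<Rightarrow> ('u, 'o, 'm) qcat
    \<Rightarrow> (('u, 'o, 'm) presheaf, 'o, 'm) presheaf \<Rightarrow> ('u, 'o, 'm) presheaf" where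
  "Psh_mult Q A \<Theta> =
     (fst \<Theta>, \<lambda>a\<in>ob A. homSup Q (fst \<Theta>) (ty A a) ((\<lambda>\<phi>. snd \<phi> a \<cdot>\<^bsub>Q\<^esub> snd \<Theta> \<phi>) ` ob (Psh Q A)))"


section \<open>The 2-category of small enriched categories\<close>

text \<open>A set-theoretic universe is rendered as a family \<open>U\<close> of subsets of a type, closed under
  subsets and, up to bijection, under binary products and power sets (every Grothendieck universe
  is of this form). A set of any type is small if it is in bijection with a member of \<open>U\<close>.\<close>

definition universe :: "'u set set \<Rightarrow> bool" where
  "universe U \<longleftrightarrow>
     U \<noteq> {} \<and>
     (\<forall>S\<in>U. \<forall>S'. S' \<subseteq> S \<longrightarrow> S' \<in> U) \<and>
     (\<forall>S\<in>U. \<forall>S'\<in>U. \<exists>P\<in>U. S \<times> S' \<approx> P) \<and>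
     (\<forall>S\<in>U. \<exists>P\<in>U. Pow S \<approx> P)"

definition small :: "'u set set \<Rightarrow> 'x set \<Rightarrow> bool" where
  "small U X \<longleftrightarrow> (\<exists>S\<in>U. X \<approx> S)"

definition small_quantaloid :: "'u set set \<Rightarrow> ('o, 'm) quantaloid \<Rightarrow> bool" where
  "small_quantaloid U Q \<longleftrightarrow> quantaloid Q \<and> small U (obj Q) \<and> small U (arr Q)"

definition QCat :: "('o, 'm) quantaloid \<Rightarrow> 'u set set \<Rightarrow> ('u, 'o, 'm) qcat set" where
  "QCat Q U = {A. qcategory Q A \<and> ob A \<in> U}"

text \<open>For \<open>A\<close> in \<open>QCat Q U\<close> the category \<open>Psh Q A\<close> has a small set of objects, hence it is isomorphic
  to a member of \<open>QCat Q U\<close>; it is kept on its own type of objects rather than re-encoded.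

  As local orders are preorders, equations between functors hold up to \<open>fun_iso\<close>.
  The action \<open>Tm A B F\<close> of a 2-functor on a functor \<open>F\<close> carries the domain and codomain of \<open>F\<close>.\<close>

locale two_functor =
  fixes Q :: "('o, 'm) quantaloid"
    and U :: "'u set set"
    and T :: "('u, 'o, 'm) qcat \<Rightarrow> ('u, 'o, 'm) qcat"
    and Tm :: "('u, 'o, 'm) qcat \<Rightarrow> ('u, 'o, 'm) qcat \<Rightarrow> ('u \<Rightarrow> 'u) \<Rightarrow> 'u \<Rightarrow> 'u"
  assumes T_ob: "A \<in> QCat Q U \<Longrightarrow> T A \<in> QCat Q U"
    and Tm_functor: "\<lbrakk>A \<in> QCat Q U; B \<in> QCat Q U; qfunctor Q A B F\<rbrakk>
      \<Longrightarrow> qfunctor Q (T A) (T B) (Tm A B F)"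
    and Tm_mono: "\<lbrakk>A \<in> QCat Q U; B \<in> QCat Q U; qfunctor Q A B F; qfunctor Q A B G; fun_le Q A B F G\<rbrakk>
      \<Longrightarrow> fun_le Q (T A) (T B) (Tm A B F) (Tm A B G)"
    and Tm_id: "A \<in> QCat Q U \<Longrightarrow> fun_iso Q (T A) (T A) (Tm A A id) id"
    and Tm_comp: "\<lbrakk>A \<in> QCat Q U; B \<in> QCat Q U; C \<in> QCat Q U; qfunctor Q A B F; qfunctor Q B C G\<rbrakk>
      \<Longrightarrow> fun_iso Q (T A) (T C) (Tm A C (G \<circ> F)) (Tm B C G \<circ> Tm A B F)"

locale two_monad = two_functor Q U T Tm
  for Q :: "('o, 'm) quantaloid" and U :: "'u set set" and T Tm +
  fixes \<mu> :: "('u, 'o, 'm) qcat \<Rightarrow> 'u \<Rightarrow> 'u"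
    and \<eta> :: "('u, 'o, 'm) qcat \<Rightarrow> 'u \<Rightarrow> 'u"
  assumes \<mu>_functor: "A \<in> QCat Q U \<Longrightarrow> qfunctor Q (T (T A)) (T A) (\<mu> A)"
    and \<eta>_functor: "A \<in> QCat Q U \<Longrightarrow> qfunctor Q A (T A) (\<eta> A)"
    and \<mu>_natural: "\<lbrakk>A \<in> QCat Q U; B \<in> QCat Q U; qfunctor Q A B F\<rbrakk>
      \<Longrightarrow> fun_iso Q (T (T A)) (T B) (\<mu> B \<circ> Tm (T A) (T B) (Tm A B F)) (Tm A B F \<circ> \<mu> A)"
    and \<eta>_natural: "\<lbrakk>A \<in> QCat Q U; B \<in> QCat Q U; qfunctor Q A B F\<rbrakk>
      \<Longrightarrow> fun_iso Q A (T B) (\<eta> B \<circ> F) (Tm A B F \<circ> \<eta> A)"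
    and \<mu>_assoc: "A \<in> QCat Q U
      \<Longrightarrow> fun_iso Q (T (T (T A))) (T A) (\<mu> A \<circ> Tm (T (T A)) (T A) (\<mu> A)) (\<mu> A \<circ> \<mu> (T A))"
    and \<mu>_T\<eta>: "A \<in> QCat Q U \<Longrightarrow> fun_iso Q (T A) (T A) (\<mu> A \<circ> Tm A (T A) (\<eta> A)) id"
    and \<mu>_\<eta>T: "A \<in> QCat Q U \<Longrightarrow> fun_iso Q (T A) (T A) (\<mu> A \<circ> \<eta> (T A)) id"

locale KZ_doctrine = two_monad Q U T Tm \<mu> \<eta>
  for Q :: "('o, 'm) quantaloid" and U :: "'u set set" and T Tm \<mu> \<eta> +
  assumes KZ: "A \<in> QCat Q U \<Longrightarrow> fun_le Q (T A) (T (T A)) (Tm A (T A) (\<eta> A)) (\<eta> (T A))"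

text \<open>A 2-natural transformation with fully faithful components from the doctrine to presheaves,
  compatible with units and multiplications. In the last condition,
  \<open>Psh_map Q (T A) (Psh Q A) (\<epsilon> A) \<circ> \<epsilon> (T A)\<close> is the component at \<open>A\<close> of the horizontal composite of
  \<open>\<epsilon>\<close> with itself.\<close>

definition full_sub_KZ_doctrine ::
  "('o, 'm) quantaloid \<Rightarrow> 'u set set
    \<Rightarrow> (('u, 'o, 'm) qcat \<Rightarrow> ('u, 'o, 'm) qcat)
    \<Rightarrow> (('u, 'o, 'm) qcat \<Rightarrow> ('u, 'o, 'm) qcat \<Rightarrow> ('u \<Rightarrow> 'u) \<Rightarrow> 'u \<Rightarrow> 'u)
    \<Rightarrow> (('u, 'o, 'm) qcat \<Rightarrow> 'u \<Rightarrow> 'u) \<Rightarrow> (('u, 'o, 'm) qcat \<Rightarrow> 'u \<Rightarrow> 'u) \<Rightarrow> bool" where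
  "full_sub_KZ_doctrine Q U T Tm \<mu> \<eta> \<longleftrightarrow>
     (\<exists>\<epsilon> :: ('u, 'o, 'm) qcat \<Rightarrow> 'u \<Rightarrow> ('u, 'o, 'm) presheaf.
        (\<forall>A\<in>QCat Q U. fully_faithful Q (T A) (Psh Q A) (\<epsilon> A)) \<and>
        (\<forall>A\<in>QCat Q U. \<forall>B\<in>QCat Q U. \<forall>F. qfunctor Q A B F \<longrightarrow>
           fun_iso Q (T A) (Psh Q B) (\<epsilon> B \<circ> Tm A B F) (Psh_map Q A B F \<circ> \<epsilon> A)) \<and>
        (\<forall>A\<in>QCat Q U. fun_iso Q A (Psh Q A) (yoneda A) (\<epsilon> A \<circ> \<eta> A)) \<and>
        (\<forall>A\<in>QCat Q U. fun_iso Q (T (T A)) (Psh Q A)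
           (Psh_mult Q A \<circ> (Psh_map Q (T A) (Psh Q A) (\<epsilon> A) \<circ> \<epsilon> (T A))) (\<epsilon> A \<circ> \<mu> A)))"

end

theory Submission
  imports Defs
begin

text \<open>The functor \<open>N A\<close> sending \<open>t\<close> to the presheaf \<open>T A (\<eta> A -, t)\<close> is always the left Kan extension
  of \<open>yoneda A\<close> through \<open>\<eta> A\<close>, and by the Yoneda lemma a fully faithful \<open>\<epsilon> A\<close> with \<open>\<epsilon> A \<circ> \<eta> A = yoneda A\<close>
  must agree with it. This gives one direction.

  Conversely, let all \<open>\<eta> A\<close> be fully faithful, so that \<open>N A \<circ> \<eta> A = yoneda A\<close>. For a small copy \<open>X\<close> of
  \<open>Psh Q B\<close>, composing \<open>N X\<close> with the colimit functor of presheaf categories gives a retraction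
  \<open>\<alpha>\<close> of \<open>\<eta> X\<close>, which by the KZ-inequality is a \<open>T\<close>-algebra structure. Hence every functor \<open>H\<close> from \<open>A\<close>
  to \<open>X\<close> has \<open>\<alpha> \<circ> T H\<close> as its least extension to \<open>T A\<close>. Applied to the Yoneda embedding this
  yields the nontrivial inequalities in the naturality of \<open>N\<close> and in its compatibility with the
  multiplications; the reverse ones are computed entrywise.\<close>


section \<open>Order on objects and functors\<close>

context quantaloid
begin

section \<open>Suprema in hom-lattices and monotonicity of composition\<close>

lemma hom_obj:
  assumes "f \<in> hom Q X Y"
  shows "X \<in> obj Q" "Y \<in> obj Q"
  using assms src_obj tgt_obj by (auto simp: hom_def)

lemma leq_refl: "f \<in> hom Q X Y \<Longrightarrow> f \<preceq> f"
proof -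
  assume f: "f \<in> hom Q X Y"
  interpret L: complete_lattice "homlat Q X Y" using complete_homlat hom_obj[OF f] by blast
  show ?thesis using L.le_refl f by (simp add: homlat_def)
qed

lemma leq_antisym:
  assumes f: "f \<in> hom Q X Y" and g: "g \<in> hom Q X Y" and "f \<preceq> g" "g \<preceq> f"
  shows "f = g"
proof -
  interpret L: complete_lattice "homlat Q X Y" using complete_homlat hom_obj[OF f] by blast
  show ?thesis using L.le_antisym assms by (simp add: homlat_def)
qed

lemma leq_trans:
  assumes "f \<preceq> g" "g \<preceq> h" and f: "f \<in> hom Q X Y" and "g \<in> hom Q X Y" "h \<in> hom Q X Y"
  shows "f \<preceq> h"
proof -
  interpret L: complete_lattice "homlat Q X Y" using complete_homlat hom_obj[OF f] by blast
  show ?thesis using L.le_trans[of f g h] assms by (simp add: homlat_def)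
qed

lemma homSup_hom:
  assumes "X \<in> obj Q" "Y \<in> obj Q" "S \<subseteq> hom Q X Y"
  shows "homSup Q X Y S \<in> hom Q X Y"
proof -
  interpret L: complete_lattice "homlat Q X Y" using complete_homlat assms by blast
  show ?thesis using L.sup_closed[of S] assms by (simp add: homlat_def)
qed

lemma homSup_upper:
  assumes "X \<in> obj Q" "Y \<in> obj Q" "S \<subseteq> hom Q X Y" "f \<in> S"
  shows "f \<preceq> homSup Q X Y S"
proof -
  interpret L: complete_lattice "homlat Q X Y" using complete_homlat assms by blast
  show ?thesis using L.sup_upper[of S f] assms by (simp add: homlat_def)
qed

lemma homSup_least:
  assumes "X \<in> obj Q" "Y \<in> obj Q" "S \<subseteq> hom Q X Y" "g \<in> hom Q X Y" "\<And>f. f \<in> S \<Longrightarrow> f \<preceq> g"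
  shows "homSup Q X Y S \<preceq> g"
proof -
  interpret L: complete_lattice "homlat Q X Y" using complete_homlat assms by blast
  show ?thesis using L.sup_least[of S g] assms by (simp add: homlat_def Upper_def)
qed

lemma homSup_eqI:
  assumes "X \<in> obj Q" "Y \<in> obj Q" "S \<subseteq> hom Q X Y" "g \<in> S" "\<And>f. f \<in> S \<Longrightarrow> f \<preceq> g"
  shows "homSup Q X Y S = g"
  by (rule leq_antisym[of _ X Y]) (use assms in \<open>auto intro: homSup_hom homSup_upper homSup_least\<close>)

text \<open>\<open>f \<preceq> f'\<close> makes \<open>f'\<close> the supremum of
  \<open>{f, f'}\<close>, so this is the binary case of the preservation of suprema.\<close>

lemma cmp_mono_right:
  assumes "f \<in> hom Q X Y" "f' \<in> hom Q X Y" "g \<in> hom Q Y Z" "f \<preceq> f'"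
  shows "g \<cdot> f \<preceq> g \<cdot> f'"
proof -
  have "homSup Q X Y {f, f'} = f'"
    using assms by (intro homSup_eqI) (auto intro: leq_refl dest: hom_obj)
  then have "g \<cdot> f' = homSup Q X Z ((\<lambda>f. g \<cdot> f) ` {f, f'})"
    using cmp_Sup[of X "{f, f'}" Y g Z] assms hom_obj by auto
  also have "g \<cdot> f \<preceq> \<dots>"
    using assms by (intro homSup_upper) (auto intro: cmp_hom dest: hom_obj)
  finally show ?thesis .
qed

lemma cmp_mono_left:
  assumes "f \<in> hom Q X Y" "g \<in> hom Q Y Z" "g' \<in> hom Q Y Z" "g \<preceq> g'"
  shows "g \<cdot> f \<preceq> g' \<cdot> f"
proof -
  have "homSup Q Y Z {g, g'} = g'"
    using assms by (intro homSup_eqI) (auto intro: leq_refl dest: hom_obj)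
  then have "g' \<cdot> f = homSup Q X Z ((\<lambda>g. g \<cdot> f) ` {g, g'})"
    using Sup_cmp[of Z f X Y "{g, g'}"] assms hom_obj by auto
  also have "g \<cdot> f \<preceq> \<dots>"
    using assms by (intro homSup_upper) (auto intro: cmp_hom dest: hom_obj)
  finally show ?thesis .
qed

lemma cmp_mono:
  assumes "f \<in> hom Q X Y" "f' \<in> hom Q X Y" "g \<in> hom Q Y Z" "g' \<in> hom Q Y Z" "f \<preceq> f'" "g \<preceq> g'"
  shows "g \<cdot> f \<preceq> g' \<cdot> f'"
  by (rule leq_trans[of _ "g \<cdot> f'" _ X Z])
    (use assms in \<open>auto intro: cmp_hom cmp_mono_left cmp_mono_right\<close>)

end

text \<open>The underlying preorder of an enriched category within each type. It allows inequalities
  of functors to be argued value by value, see \<open>fun_le_iff\<close>.\<close>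

definition obj_le :: "('o, 'm) quantaloid \<Rightarrow> ('u, 'o, 'm) qcat \<Rightarrow> 'u \<Rightarrow> 'u \<Rightarrow> bool" where
  "obj_le Q A x y \<longleftrightarrow> x \<in> ob A \<and> y \<in> ob A \<and> ty A x = ty A y \<and> unt Q (ty A x) \<preceq>\<^bsub>Q\<^esub> hm A x y"

lemma qfunctor_ob: "qfunctor Q A B F \<Longrightarrow> a \<in> ob A \<Longrightarrow> F a \<in> ob B"
  by (auto simp: qfunctor_def)

lemma qfunctor_ty: "qfunctor Q A B F \<Longrightarrow> a \<in> ob A \<Longrightarrow> ty B (F a) = ty A a"
  by (auto simp: qfunctor_def)

lemma qfunctor_hm:
  "qfunctor Q A B F \<Longrightarrow> a \<in> ob A \<Longrightarrow> a' \<in> ob A \<Longrightarrow> hm A a' a \<preceq>\<^bsub>Q\<^esub> hm B (F a') (F a)"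
  by (auto simp: qfunctor_def)

lemma qcategory_ty: "qcategory Q A \<Longrightarrow> a \<in> ob A \<Longrightarrow> ty A a \<in> obj Q"
  by (auto simp: qcategory_def)

lemma qcategory_hom:
  "qcategory Q A \<Longrightarrow> a \<in> ob A \<Longrightarrow> a' \<in> ob A \<Longrightarrow> ty A a = X \<Longrightarrow> ty A a' = Y \<Longrightarrow> hm A a' a \<in> hom Q X Y"
  by (auto simp: qcategory_def)

lemma qcategory_unt: "qcategory Q A \<Longrightarrow> a \<in> ob A \<Longrightarrow> unt Q (ty A a) \<preceq>\<^bsub>Q\<^esub> hm A a a"
  by (auto simp: qcategory_def)

lemma qcategory_cmp:
  "qcategory Q A \<Longrightarrow> a \<in> ob A \<Longrightarrow> a' \<in> ob A \<Longrightarrow> a'' \<in> ob A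
    \<Longrightarrow> hm A a'' a' \<cdot>\<^bsub>Q\<^esub> hm A a' a \<preceq>\<^bsub>Q\<^esub> hm A a'' a"
  by (auto simp: qcategory_def)

lemma fully_faithful_qfunctor: "fully_faithful Q A B F \<Longrightarrow> qfunctor Q A B F"
  by (simp add: fully_faithful_def)

lemma fully_faithful_hm:
  "fully_faithful Q A B F \<Longrightarrow> a \<in> ob A \<Longrightarrow> a' \<in> ob A \<Longrightarrow> hm B (F a') (F a) = hm A a' a"
  by (simp add: fully_faithful_def)

context quantaloid
begin

lemma qfunctor_id: "qcategory Q A \<Longrightarrow> qfunctor Q A A id"
  by (auto simp: qfunctor_def intro: leq_refl dest: qcategory_hom)

lemma qfunctor_comp:
  assumes "qcategory Q A" "qcategory Q B" "qcategory Q C" "qfunctor Q A B F" "qfunctor Q B C G"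
  shows "qfunctor Q A C (G \<circ> F)"
  unfolding qfunctor_def
proof (intro conjI ballI)
  show "G \<circ> F \<in> ob A \<rightarrow> ob C" using assms by (auto simp: qfunctor_ob)
next
  fix a assume "a \<in> ob A"
  then show "ty C ((G \<circ> F) a) = ty A a"
    using assms by (simp add: qfunctor_ob qfunctor_ty)
next
  fix a a' assume a: "a \<in> ob A" "a' \<in> ob A"
  show "hm A a' a \<preceq> hm C ((G \<circ> F) a') ((G \<circ> F) a)"
  proof (rule leq_trans)
    show "hm A a' a \<preceq> hm B (F a') (F a)" by (rule qfunctor_hm[OF assms(4) a])
    show "hm B (F a') (F a) \<preceq> hm C ((G \<circ> F) a') ((G \<circ> F) a)"
      using assms a by (simp add: qfunctor_hm qfunctor_ob)
    show "hm A a' a \<in> hom Q (ty A a) (ty A a')" using assms a by (simp add: qcategory_hom)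
    show "hm B (F a') (F a) \<in> hom Q (ty A a) (ty A a')"
      using assms a by (auto intro!: qcategory_hom[of Q B] simp: qfunctor_ob qfunctor_ty)
    show "hm C ((G \<circ> F) a') ((G \<circ> F) a) \<in> hom Q (ty A a) (ty A a')"
      using assms a by (auto intro!: qcategory_hom[of Q C] simp: qfunctor_ob qfunctor_ty)
  qed
qed

lemma obj_le_refl: "qcategory Q A \<Longrightarrow> x \<in> ob A \<Longrightarrow> obj_le Q A x x"
  by (simp add: obj_le_def qcategory_unt)

text \<open>Insert the identity on \<open>ty A x\<close>, enlarge it to \<open>hm A x y\<close> and
  compose in \<open>A\<close>. The next lemma is the dual argument.\<close>

lemma hm_mono_right:
  assumes A: "qcategory Q A" and b: "b \<in> ob A" and le: "obj_le Q A x y"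
  shows "hm A b x \<preceq> hm A b y"
proof -
  have xy: "x \<in> ob A" "y \<in> ob A" "ty A x = ty A y" and u: "unt Q (ty A x) \<preceq> hm A x y"
    using le by (auto simp: obj_le_def)
  have h: "hm A b x \<in> hom Q (ty A x) (ty A b)" "hm A x y \<in> hom Q (ty A x) (ty A x)"
     "hm A b y \<in> hom Q (ty A x) (ty A b)" "unt Q (ty A x) \<in> hom Q (ty A x) (ty A x)"
    using b xy qcategory_ty[OF A xy(1)] by (auto intro!: qcategory_hom[OF A] unt_hom)
  have "hm A b x \<cdot> unt Q (ty A x) \<preceq> hm A b x \<cdot> hm A x y"
    using cmp_mono_right[OF h(4) h(2) h(1) u] .
  moreover have "hm A b x \<cdot> unt Q (ty A x) = hm A b x" using cmp_unt h by blast
  moreover have "hm A b x \<cdot> hm A x y \<preceq> hm A b y" using qcategory_cmp A b xy by fast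
  ultimately show ?thesis using leq_trans[of _ "hm A b x \<cdot> hm A x y"] h cmp_hom[OF h(2,1)] by auto
qed

lemma hm_mono_left:
  assumes A: "qcategory Q A" and b: "b \<in> ob A" and le: "obj_le Q A x y"
  shows "hm A y b \<preceq> hm A x b"
proof -
  have xy: "x \<in> ob A" "y \<in> ob A" "ty A x = ty A y" and u: "unt Q (ty A x) \<preceq> hm A x y"
    using le by (auto simp: obj_le_def)
  have h: "hm A y b \<in> hom Q (ty A b) (ty A x)" "hm A x y \<in> hom Q (ty A x) (ty A x)"
     "hm A x b \<in> hom Q (ty A b) (ty A x)" "unt Q (ty A x) \<in> hom Q (ty A x) (ty A x)"
    using b xy qcategory_ty[OF A xy(1)] by (auto intro!: qcategory_hom[OF A] unt_hom)
  have "unt Q (ty A x) \<cdot> hm A y b \<preceq> hm A x y \<cdot> hm A y b"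
    using cmp_mono_left[OF h(1) h(4) h(2) u] .
  moreover have "unt Q (ty A x) \<cdot> hm A y b = hm A y b" using unt_cmp h by blast
  moreover have "hm A x y \<cdot> hm A y b \<preceq> hm A x b" using qcategory_cmp A b xy by fast
  ultimately show ?thesis using leq_trans[of _ "hm A x y \<cdot> hm A y b"] h cmp_hom[OF h(1,2)] by auto
qed

lemma obj_le_trans:
  assumes A: "qcategory Q A" and xy: "obj_le Q A x y" and yz: "obj_le Q A y z"
  shows "obj_le Q A x z"
proof -
  have o: "x \<in> ob A" "y \<in> ob A" "z \<in> ob A" "ty A x = ty A y" "ty A z = ty A y"
    and u: "unt Q (ty A y) \<preceq> hm A x y"
    using assms by (auto simp: obj_le_def)
  have "hm A x y \<preceq> hm A x z" using hm_mono_right[OF A o(1) yz] .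
  then have "unt Q (ty A y) \<preceq> hm A x z"
  proof (rule leq_trans[OF u])
    show "unt Q (ty A y) \<in> hom Q (ty A y) (ty A y)" using unt_hom qcategory_ty[OF A o(2)] .
  qed (use o in \<open>auto intro!: qcategory_hom[OF A]\<close>)
  then show ?thesis using o by (simp add: obj_le_def)
qed

lemma qfunctor_obj_le:
  assumes "qcategory Q A" "qcategory Q B" "qfunctor Q A B F" "obj_le Q A x y"
  shows "obj_le Q B (F x) (F y)"
proof -
  have o: "x \<in> ob A" "y \<in> ob A" "ty A x = ty A y" and u: "unt Q (ty A x) \<preceq> hm A x y"
    using assms by (auto simp: obj_le_def)
  have "unt Q (ty A x) \<preceq> hm B (F x) (F y)"
  proof (rule leq_trans[OF u])
    show "hm A x y \<preceq> hm B (F x) (F y)" using qfunctor_hm[OF assms(3)] o by simp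
    show "unt Q (ty A x) \<in> hom Q (ty A x) (ty A x)" using unt_hom qcategory_ty[OF assms(1) o(1)] .
    show "hm A x y \<in> hom Q (ty A x) (ty A x)" using assms(1) o by (auto intro!: qcategory_hom)
    show "hm B (F x) (F y) \<in> hom Q (ty A x) (ty A x)"
      using assms o by (auto intro!: qcategory_hom[of Q B] simp: qfunctor_ob qfunctor_ty)
  qed
  then show ?thesis using o assms(3) by (simp add: obj_le_def qfunctor_ob qfunctor_ty)
qed

text \<open>A Yoneda argument: the row \<open>b = F a\<close> of the distributor inequality,
  together with the identity below \<open>hm B (F a) (F a)\<close>, gives the pointwise inequality.
  The converse is monotonicity of hom-arrows in the right argument.\<close>

lemma fun_le_iff:
  assumes A: "qcategory Q A" and B: "qcategory Q B" and F: "qfunctor Q A B F"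
    and G: "qfunctor Q A B G"
  shows "fun_le Q A B F G \<longleftrightarrow> (\<forall>a\<in>ob A. obj_le Q B (F a) (G a))"
proof
  assume le: "fun_le Q A B F G"
  show "\<forall>a\<in>ob A. obj_le Q B (F a) (G a)"
  proof
    fix a assume a: "a \<in> ob A"
    have o: "F a \<in> ob B" "G a \<in> ob B" "ty B (F a) = ty A a" "ty B (G a) = ty A a"
      using a F G by (auto simp: qfunctor_ob qfunctor_ty)
    have le1: "hm B (F a) (F a) \<preceq> hm B (F a) (G a)"
      using le a o by (auto simp: fun_le_def dist_le_def fdist_def)
    have "unt Q (ty A a) \<preceq> hm B (F a) (G a)"
    proof (rule leq_trans[OF _ le1])
      show "unt Q (ty A a) \<preceq> hm B (F a) (F a)" using qcategory_unt[OF B o(1)] o by simp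
      show "unt Q (ty A a) \<in> hom Q (ty A a) (ty A a)" using unt_hom qcategory_ty[OF A a] .
    qed (use o in \<open>auto intro!: qcategory_hom[OF B]\<close>)
    then show "obj_le Q B (F a) (G a)" using o by (simp add: obj_le_def)
  qed
next
  assume "\<forall>a\<in>ob A. obj_le Q B (F a) (G a)"
  then show "fun_le Q A B F G"
    using hm_mono_right[OF B] by (simp add: fun_le_def dist_le_def fdist_def)
qed

lemma fun_le_obj_le:
  "\<lbrakk>fun_le Q A B F G; qcategory Q A; qcategory Q B; qfunctor Q A B F; qfunctor Q A B G; a \<in> ob A\<rbrakk>
    \<Longrightarrow> obj_le Q B (F a) (G a)"
  using fun_le_iff by blast

text \<open>Hom-lattices are antisymmetric, so mutual inequalities of hom-arrows become equations.
  This is why full faithfulness, which is an equation, is invariant under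
  \<open>fun_iso\<close>.\<close>

lemma hm_cong:
  assumes A: "qcategory Q A" and "obj_le Q A x x'" "obj_le Q A x' x" "obj_le Q A y y'" "obj_le Q A y' y"
  shows "hm A x y = hm A x' y'"
proof -
  have o: "x \<in> ob A" "y \<in> ob A" "x' \<in> ob A" "y' \<in> ob A" "ty A x = ty A x'" "ty A y' = ty A y"
    using assms by (auto simp: obj_le_def)
  have h: "hm A x y \<in> hom Q (ty A y) (ty A x)" "hm A x y' \<in> hom Q (ty A y) (ty A x)"
    "hm A x' y' \<in> hom Q (ty A y) (ty A x)"
    using o by (auto intro!: qcategory_hom[OF A])
  have "hm A x y = hm A x y'"
    using leq_antisym[OF h(1,2)] hm_mono_right[OF A o(1)] assms by blast
  also have "\<dots> = hm A x' y'"
    using leq_antisym[OF h(2,3)] hm_mono_left[OF A o(4)] assms by blast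
  finally show ?thesis .
qed

lemma fully_faithful_cong:
  assumes A: "qcategory Q A" and B: "qcategory Q B" and G: "qfunctor Q A B G"
    and iso: "fun_iso Q A B F G" and F: "fully_faithful Q A B F"
  shows "fully_faithful Q A B G"
proof -
  have F': "qfunctor Q A B F" using F by (simp add: fully_faithful_def)
  have "obj_le Q B (F a) (G a)" "obj_le Q B (G a) (F a)" if "a \<in> ob A" for a
    using iso fun_le_iff[OF A B] F' G that by (auto simp: fun_iso_def)
  then show ?thesis using F G by (auto simp: fully_faithful_def intro!: hm_cong[OF B])
qed

end


section \<open>Presheaves, nerves and weighted colimits\<close>

text \<open>The presheaf \<open>C(G-, c)\<close>; restriction to \<open>ob A\<close> makes its
  column extensional, as \<open>Psh\<close> demands.\<close>

definition nerve ::
  "('u, 'o, 'm) qcat \<Rightarrow> ('v, 'o, 'm) qcat \<Rightarrow> ('u \<Rightarrow> 'v) \<Rightarrow> 'v \<Rightarrow> ('u, 'o, 'm) presheaf" where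
  "nerve A C G c = (ty C c, \<lambda>a\<in>ob A. hm C (G a) c)"

text \<open>The colimit of the diagram \<open>g\<close> of presheaves weighted by
  \<open>\<Theta>\<close>, computed entrywise. It covers the multiplication (\<open>g = id\<close>)
  and the action on functors (\<open>g = yoneda B \<circ> F\<close>) of the presheaf monad, so that
  both share one set of estimates.\<close>

definition wcolim ::
  "('o, 'm) quantaloid \<Rightarrow> ('v, 'o, 'm) qcat \<Rightarrow> ('u, 'o, 'm) qcat \<Rightarrow> ('v \<Rightarrow> ('u, 'o, 'm) presheaf)
    \<Rightarrow> ('v, 'o, 'm) presheaf \<Rightarrow> ('u, 'o, 'm) presheaf" where
  "wcolim Q X A g \<Theta> =
     (fst \<Theta>, \<lambda>a\<in>ob A. homSup Q (fst \<Theta>) (ty A a) ((\<lambda>x. snd (g x) a \<cdot>\<^bsub>Q\<^esub> snd \<Theta> x) ` ob X))"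

lemma yoneda_eq_nerve: "yoneda A = nerve A A id"
  by (simp add: yoneda_def nerve_def fun_eq_iff)

lemma Psh_mult_eq_wcolim: "Psh_mult Q A = wcolim Q (Psh Q A) A id"
  by (simp add: Psh_mult_def wcolim_def fun_eq_iff)

lemma Psh_map_eq_wcolim: "Psh_map Q A B F = wcolim Q A B (yoneda B \<circ> F)"
  by (auto simp: Psh_map_def wcolim_def fun_eq_iff dist_comp_def fdist_def col_def star_def yoneda_def
      restrict_def)

lemma ty_Psh [simp]: "ty (Psh Q A) = fst"
  by (simp add: Psh_def)

context quantaloid
begin

section \<open>Presheaves as columns of arrows, with homs as largest admissible arrows\<close>

lemma Psh_ob_iff:
  "\<phi> \<in> ob (Psh Q A) \<longleftrightarrow>
     fst \<phi> \<in> obj Q \<and> snd \<phi> \<in> extensional (ob A) \<and>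
     (\<forall>a\<in>ob A. snd \<phi> a \<in> hom Q (fst \<phi>) (ty A a)) \<and>
     (\<forall>a\<in>ob A. \<forall>b\<in>ob A. hm A b a \<cdot> snd \<phi> a \<preceq> snd \<phi> b)"
proof -
  \<comment> \<open>Compatibility with the one-object category \<open>star\<close> is the right unit
    law; only the action of \<open>A\<close> remains as a condition.\<close>
  have "snd \<phi> b \<cdot> unt Q (fst \<phi>) \<preceq> snd \<phi> b" if "\<forall>a\<in>ob A. snd \<phi> a \<in> hom Q (fst \<phi>) (ty A a)" "b \<in> ob A" for b
    using that cmp_unt[of "snd \<phi> b"] leq_refl[of "snd \<phi> b"] by fastforce
  then show ?thesis by (auto simp: Psh_def distributor_def star_def col_def)
qed

lemma Psh_objD: "\<phi> \<in> ob (Psh Q A) \<Longrightarrow> fst \<phi> \<in> obj Q"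
  by (simp add: Psh_ob_iff)

lemma Psh_homD: "\<phi> \<in> ob (Psh Q A) \<Longrightarrow> a \<in> ob A \<Longrightarrow> fst \<phi> = X \<Longrightarrow> ty A a = Y \<Longrightarrow> snd \<phi> a \<in> hom Q X Y"
  by (auto simp: Psh_ob_iff)

lemma Psh_actD: "\<phi> \<in> ob (Psh Q A) \<Longrightarrow> a \<in> ob A \<Longrightarrow> b \<in> ob A \<Longrightarrow> hm A b a \<cdot> snd \<phi> a \<preceq> snd \<phi> b"
  by (simp add: Psh_ob_iff)

lemma Psh_eqI:
  assumes "\<phi> \<in> ob (Psh Q A)" "\<psi> \<in> ob (Psh Q A)" "fst \<phi> = fst \<psi>" "\<And>a. a \<in> ob A \<Longrightarrow> snd \<phi> a = snd \<psi> a"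
  shows "\<phi> = \<psi>"
  using assms extensionalityI[of "snd \<phi>" "ob A" "snd \<psi>"] by (auto simp: Psh_ob_iff prod_eq_iff)

lemma distributor_star:
  assumes "X \<in> obj Q" "Y \<in> obj Q"
  shows "distributor Q (star Q X) (star Q Y) \<Theta> \<longleftrightarrow> \<Theta> () () \<in> hom Q X Y"
  using assms by (auto simp: distributor_def star_def cmp_unt unt_cmp intro: leq_refl)

lemma dist_comp_star:
  assumes A: "qcategory Q A" and \<psi>: "\<psi> \<in> ob (Psh Q A)" and a: "a \<in> ob A" and X: "X \<in> obj Q"
    and \<Theta>: "\<Theta> () () \<in> hom Q X (fst \<psi>)"
  shows "dist_comp Q (star Q X) (star Q (fst \<psi>)) A (col \<psi>) \<Theta> a () = snd \<psi> a \<cdot> \<Theta> () ()"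
proof -
  have h: "snd \<psi> a \<cdot> \<Theta> () () \<in> hom Q X (ty A a)" using cmp_hom[OF \<Theta> Psh_homD[OF \<psi> a refl refl]] .
  have "homSup Q X (ty A a) {snd \<psi> a \<cdot> \<Theta> () ()} = snd \<psi> a \<cdot> \<Theta> () ()"
    using h X qcategory_ty[OF A a] by (intro homSup_eqI) (auto intro: leq_refl)
  then show ?thesis by (simp add: dist_comp_def star_def col_def)
qed

text \<open>A distributor between one-object categories is a single arrow and its composite with
  \<open>col \<psi>\<close> is a supremum of one term. So the lifting is the largest arrow
  \<open>f\<close> with \<open>snd \<psi> a \<cdot> f \<preceq> snd \<phi> a\<close> for all
  \<open>a\<close>.\<close>

lemma is_lifting_Psh_iff:
  assumes A: "qcategory Q A" and \<phi>: "\<phi> \<in> ob (Psh Q A)" and \<psi>: "\<psi> \<in> ob (Psh Q A)"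
  shows "is_lifting Q (star Q (fst \<phi>)) (star Q (fst \<psi>)) A (col \<psi>) (col \<phi>) \<Theta> \<longleftrightarrow>
    \<Theta> () () \<in> hom Q (fst \<phi>) (fst \<psi>) \<and> (\<forall>a\<in>ob A. snd \<psi> a \<cdot> \<Theta> () () \<preceq> snd \<phi> a) \<and>
    (\<forall>f\<in>hom Q (fst \<phi>) (fst \<psi>). (\<forall>a\<in>ob A. snd \<psi> a \<cdot> f \<preceq> snd \<phi> a) \<longrightarrow> f \<preceq> \<Theta> () ())"
proof -
  note o = Psh_objD[OF \<phi>] Psh_objD[OF \<psi>]
  have le: "dist_le Q (star Q (fst \<phi>)) A
      (dist_comp Q (star Q (fst \<phi>)) (star Q (fst \<psi>)) A (col \<psi>) \<Theta>) (col \<phi>) \<longleftrightarrow>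
      (\<forall>a\<in>ob A. snd \<psi> a \<cdot> \<Theta> () () \<preceq> snd \<phi> a)" if "\<Theta> () () \<in> hom Q (fst \<phi>) (fst \<psi>)" for \<Theta>
    using dist_comp_star[where \<Theta> = \<Theta>, OF A \<psi> _ o(1) that] by (auto simp: dist_le_def star_def col_def)
  have le': "dist_le Q (star Q (fst \<phi>)) (star Q (fst \<psi>)) \<Theta>' \<Theta> \<longleftrightarrow> \<Theta>' () () \<preceq> \<Theta> () ()" for \<Theta>' \<Theta>
    by (simp add: dist_le_def star_def)
  \<comment> \<open>Constant matrices turn a quantifier over matrices indexed by \<open>unit\<close>
    into one over arrows.\<close>
  have all: "(\<forall>\<Theta>'::unit \<Rightarrow> unit \<Rightarrow> 'm. P (\<Theta>' () ())) \<longleftrightarrow> (\<forall>f. P f)" for P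
  proof
    assume "\<forall>\<Theta>'::unit \<Rightarrow> unit \<Rightarrow> 'm. P (\<Theta>' () ())"
    then show "\<forall>f. P f" by (auto dest: spec[of _ "\<lambda>_ _. f" for f])
  qed simp
  show ?thesis
    unfolding is_lifting_def distributor_star[OF o] le'
    using all[of "\<lambda>f. f \<in> hom Q (fst \<phi>) (fst \<psi>) \<and> (\<forall>a\<in>ob A. snd \<psi> a \<cdot> f \<preceq> snd \<phi> a) \<longrightarrow> f \<preceq> \<Theta> () ()"]
    by (simp add: le Ball_def cong: conj_cong) blast
qed

text \<open>As \<open>lifting\<close> is defined by choice, a lifting has to be exhibited: the
  supremum of all admissible arrows is admissible because composition preserves suprema.\<close>

lemma is_lifting_Psh_hm:
  assumes A: "qcategory Q A" and \<phi>: "\<phi> \<in> ob (Psh Q A)" and \<psi>: "\<psi> \<in> ob (Psh Q A)"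
  shows "\<exists>\<Theta>. is_lifting Q (star Q (fst \<phi>)) (star Q (fst \<psi>)) A (col \<psi>) (col \<phi>) \<Theta> \<and>
    hm (Psh Q A) \<psi> \<phi> = \<Theta> () ()"
proof -
  note o = Psh_objD[OF \<phi>] Psh_objD[OF \<psi>]
  define S where "S = {f \<in> hom Q (fst \<phi>) (fst \<psi>). \<forall>a\<in>ob A. snd \<psi> a \<cdot> f \<preceq> snd \<phi> a}"
  have S: "S \<subseteq> hom Q (fst \<phi>) (fst \<psi>)" by (auto simp: S_def)
  define m where "m = homSup Q (fst \<phi>) (fst \<psi>) S"
  have m: "m \<in> hom Q (fst \<phi>) (fst \<psi>)" unfolding m_def by (rule homSup_hom[OF o S])
  have "snd \<psi> a \<cdot> m \<preceq> snd \<phi> a" if a: "a \<in> ob A" for a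
  proof -
    have h: "snd \<psi> a \<in> hom Q (fst \<psi>) (ty A a)" "snd \<phi> a \<in> hom Q (fst \<phi>) (ty A a)"
      using a \<phi> \<psi> by (simp_all add: Psh_homD)
    show ?thesis unfolding m_def cmp_Sup[OF o(1) S h(1)]
      using S h a cmp_hom[OF _ h(1)] qcategory_ty[OF A a] o
      by (intro homSup_least) (auto simp: S_def)
  qed
  moreover have "f \<preceq> m" if "f \<in> S" for f
    unfolding m_def using homSup_upper[OF o S that] .
  ultimately have "is_lifting Q (star Q (fst \<phi>)) (star Q (fst \<psi>)) A (col \<psi>) (col \<phi>) (\<lambda>_ _. m)"
    using m unfolding is_lifting_Psh_iff[OF assms] by (auto simp: S_def)
  then have "is_lifting Q (star Q (fst \<phi>)) (star Q (fst \<psi>)) A (col \<psi>) (col \<phi>)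
      (lifting Q (star Q (fst \<phi>)) (star Q (fst \<psi>)) A (col \<psi>) (col \<phi>))"
    unfolding lifting_def
    by (rule someI[of "is_lifting Q (star Q (fst \<phi>)) (star Q (fst \<psi>)) A (col \<psi>) (col \<phi>)"])
  then show ?thesis by (intro exI conjI) (auto simp: Psh_def)
qed

lemma Psh_hom:
  assumes "qcategory Q A" "\<phi> \<in> ob (Psh Q A)" "\<psi> \<in> ob (Psh Q A)" "fst \<phi> = X" "fst \<psi> = Y"
  shows "hm (Psh Q A) \<psi> \<phi> \<in> hom Q X Y"
  using is_lifting_Psh_hm[OF assms(1-3)] is_lifting_Psh_iff[OF assms(1-3)] assms(4,5) by auto

lemma Psh_hm_cmp:
  assumes "qcategory Q A" "\<phi> \<in> ob (Psh Q A)" "\<psi> \<in> ob (Psh Q A)" "a \<in> ob A"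
  shows "snd \<psi> a \<cdot> hm (Psh Q A) \<psi> \<phi> \<preceq> snd \<phi> a"
  using is_lifting_Psh_hm[OF assms(1-3)] is_lifting_Psh_iff[OF assms(1-3)] assms(4) by auto

lemma Psh_hm_greatest:
  assumes "qcategory Q A" "\<phi> \<in> ob (Psh Q A)" "\<psi> \<in> ob (Psh Q A)" "f \<in> hom Q (fst \<phi>) (fst \<psi>)"
    "\<And>a. a \<in> ob A \<Longrightarrow> snd \<psi> a \<cdot> f \<preceq> snd \<phi> a"
  shows "f \<preceq> hm (Psh Q A) \<psi> \<phi>"
  using is_lifting_Psh_hm[OF assms(1-3)] is_lifting_Psh_iff[OF assms(1-3)] assms(4,5) by auto

lemma qcategory_Psh:
  assumes A: "qcategory Q A"
  shows "qcategory Q (Psh Q A)"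
  unfolding qcategory_def ty_Psh
proof (intro conjI ballI)
  fix \<phi> assume \<phi>: "\<phi> \<in> ob (Psh Q A)"
  show "fst \<phi> \<in> obj Q" using Psh_objD[OF \<phi>] .
  show "unt Q (fst \<phi>) \<preceq> hm (Psh Q A) \<phi> \<phi>"
  proof (rule Psh_hm_greatest[OF A \<phi> \<phi>])
    show "unt Q (fst \<phi>) \<in> hom Q (fst \<phi>) (fst \<phi>)" using unt_hom Psh_objD[OF \<phi>] .
    fix a assume a: "a \<in> ob A"
    have "snd \<phi> a \<in> hom Q (fst \<phi>) (ty A a)" using Psh_homD[OF \<phi> a refl refl] .
    then show "snd \<phi> a \<cdot> unt Q (fst \<phi>) \<preceq> snd \<phi> a" by (simp add: cmp_unt leq_refl)
  qed
next
  fix \<phi> \<psi> assume "\<phi> \<in> ob (Psh Q A)" "\<psi> \<in> ob (Psh Q A)"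
  then show "hm (Psh Q A) \<psi> \<phi> \<in> hom Q (fst \<phi>) (fst \<psi>)" using Psh_hom[OF A] by simp
next
  fix \<phi> \<psi> \<chi> assume p: "\<phi> \<in> ob (Psh Q A)" "\<psi> \<in> ob (Psh Q A)" "\<chi> \<in> ob (Psh Q A)"
  note h1 = Psh_hom[OF A p(1,2) refl refl] and h2 = Psh_hom[OF A p(2,3) refl refl]
  show "hm (Psh Q A) \<chi> \<psi> \<cdot> hm (Psh Q A) \<psi> \<phi> \<preceq> hm (Psh Q A) \<chi> \<phi>"
  proof (rule Psh_hm_greatest[OF A p(1,3)])
    show "hm (Psh Q A) \<chi> \<psi> \<cdot> hm (Psh Q A) \<psi> \<phi> \<in> hom Q (fst \<phi>) (fst \<chi>)" using cmp_hom[OF h1 h2] .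
    fix a assume a: "a \<in> ob A"
    note h = Psh_homD[OF p(1) a refl refl] Psh_homD[OF p(2) a refl refl] Psh_homD[OF p(3) a refl refl]
    have "(snd \<chi> a \<cdot> hm (Psh Q A) \<chi> \<psi>) \<cdot> hm (Psh Q A) \<psi> \<phi> \<preceq> snd \<psi> a \<cdot> hm (Psh Q A) \<psi> \<phi>"
      by (rule cmp_mono_left[OF h1 cmp_hom[OF h2 h(3)] h(2) Psh_hm_cmp[OF A p(2,3) a]])
    then show "snd \<chi> a \<cdot> (hm (Psh Q A) \<chi> \<psi> \<cdot> hm (Psh Q A) \<psi> \<phi>) \<preceq> snd \<phi> a"
      unfolding cmp_assoc[OF h1 h2 h(3)]
      by (rule leq_trans[OF _ Psh_hm_cmp[OF A p(1,2) a] _ cmp_hom[OF h1 h(2)] h(1)])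
        (rule cmp_hom[OF cmp_hom[OF h1 h2] h(3)])
  qed
qed

text \<open>The identity lies below the largest admissible arrow exactly when it is itself
  admissible, which is the entrywise inequality.\<close>

lemma Psh_obj_le_iff:
  assumes A: "qcategory Q A" and \<phi>: "\<phi> \<in> ob (Psh Q A)" and \<psi>: "\<psi> \<in> ob (Psh Q A)"
  shows "obj_le Q (Psh Q A) \<phi> \<psi> \<longleftrightarrow> fst \<phi> = fst \<psi> \<and> (\<forall>a\<in>ob A. snd \<phi> a \<preceq> snd \<psi> a)"
proof (cases "fst \<phi> = fst \<psi>")
  case eq: True
  note u = unt_hom[OF Psh_objD[OF \<psi>]]
  have h: "snd \<phi> a \<in> hom Q (fst \<psi>) (ty A a)" "snd \<psi> a \<in> hom Q (fst \<psi>) (ty A a)" if "a \<in> ob A" for a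
    using that eq \<phi> \<psi> by (simp_all add: Psh_homD)
  note m = Psh_hom[OF A \<psi> \<phi> refl eq]
  have "unt Q (fst \<psi>) \<preceq> hm (Psh Q A) \<phi> \<psi> \<longleftrightarrow> (\<forall>a\<in>ob A. snd \<phi> a \<preceq> snd \<psi> a)"
  proof (intro iffI ballI)
    fix a assume le: "unt Q (fst \<psi>) \<preceq> hm (Psh Q A) \<phi> \<psi>" and a: "a \<in> ob A"
    have "snd \<phi> a \<cdot> unt Q (fst \<psi>) \<preceq> snd \<psi> a"
      by (rule leq_trans[OF cmp_mono_right[OF u m h(1)[OF a] le] Psh_hm_cmp[OF A \<psi> \<phi> a]
            cmp_hom[OF u h(1)[OF a]] cmp_hom[OF m h(1)[OF a]] h(2)[OF a]])
    then show "snd \<phi> a \<preceq> snd \<psi> a" using cmp_unt[OF h(1)[OF a]] by simp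
  next
    assume "\<forall>a\<in>ob A. snd \<phi> a \<preceq> snd \<psi> a"
    then show "unt Q (fst \<psi>) \<preceq> hm (Psh Q A) \<phi> \<psi>"
      using u eq cmp_unt[OF h(1)] by (intro Psh_hm_greatest[OF A \<psi> \<phi>]) auto
  qed
  then show ?thesis using eq \<phi> \<psi> by (simp add: obj_le_def)
qed (simp add: obj_le_def)

section \<open>Nerves, the Yoneda lemma and left Kan extensions of the Yoneda embedding\<close>

lemma nerve_ob:
  assumes A: "qcategory Q A" and C: "qcategory Q C" and G: "qfunctor Q A C G" and c: "c \<in> ob C"
  shows "nerve A C G c \<in> ob (Psh Q A)"
  unfolding Psh_ob_iff
proof (intro conjI ballI)
  show "fst (nerve A C G c) \<in> obj Q" using qcategory_ty[OF C c] by (simp add: nerve_def)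
  show "snd (nerve A C G c) \<in> extensional (ob A)" by (simp add: nerve_def)
next
  fix a assume "a \<in> ob A"
  then show "snd (nerve A C G c) a \<in> hom Q (fst (nerve A C G c)) (ty A a)"
    using c by (auto simp: nerve_def intro!: qcategory_hom[OF C] simp: qfunctor_ob[OF G] qfunctor_ty[OF G])
next
  fix a b assume a: "a \<in> ob A" and b: "b \<in> ob A"
  note o = qfunctor_ob[OF G a] qfunctor_ob[OF G b]
  have h: "hm A b a \<in> hom Q (ty A a) (ty A b)" "hm C (G b) (G a) \<in> hom Q (ty A a) (ty A b)"
    "hm C (G a) c \<in> hom Q (ty C c) (ty A a)" "hm C (G b) c \<in> hom Q (ty C c) (ty A b)"
    using a b c o by (auto intro!: qcategory_hom[OF C] qcategory_hom[OF A] simp: qfunctor_ty[OF G])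
  have "hm A b a \<cdot> hm C (G a) c \<preceq> hm C (G b) c"
    by (rule leq_trans[OF cmp_mono_left[OF h(3,1,2) qfunctor_hm[OF G a b]] qcategory_cmp[OF C c o]
          cmp_hom[OF h(3,1)] cmp_hom[OF h(3,2)] h(4)])
  then show "hm A b a \<cdot> snd (nerve A C G c) a \<preceq> snd (nerve A C G c) b"
    using a b by (simp add: nerve_def)
qed

lemma qfunctor_nerve:
  assumes A: "qcategory Q A" and C: "qcategory Q C" and G: "qfunctor Q A C G"
  shows "qfunctor Q C (Psh Q A) (nerve A C G)"
  unfolding qfunctor_def ty_Psh
proof (intro conjI ballI)
  show "nerve A C G \<in> ob C \<rightarrow> ob (Psh Q A)" using nerve_ob[OF assms] by blast
  show "fst (nerve A C G c) = ty C c" for c by (simp add: nerve_def)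
next
  fix c d assume c: "c \<in> ob C" and d: "d \<in> ob C"
  show "hm C d c \<preceq> hm (Psh Q A) (nerve A C G d) (nerve A C G c)"
  proof (rule Psh_hm_greatest[OF A nerve_ob[OF assms c] nerve_ob[OF assms d]])
    show "hm C d c \<in> hom Q (fst (nerve A C G c)) (fst (nerve A C G d))"
      using qcategory_hom[OF C c d] by (simp add: nerve_def)
    fix a assume "a \<in> ob A"
    then show "snd (nerve A C G d) a \<cdot> hm C d c \<preceq> snd (nerve A C G c) a"
      using qcategory_cmp[OF C c d] qfunctor_ob[OF G] by (simp add: nerve_def)
  qed
qed

lemma qfunctor_yoneda: "qcategory Q A \<Longrightarrow> qfunctor Q A (Psh Q A) (yoneda A)"
  unfolding yoneda_eq_nerve by (intro qfunctor_nerve qfunctor_id)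

text \<open>From above: evaluate the inequality defining the hom-arrow at \<open>a\<close> and use
  the identity below \<open>hm A a a\<close>. From below: the action of \<open>A\<close> on
  \<open>\<phi>\<close> says that \<open>snd \<phi> a\<close> is admissible.\<close>

lemma yoneda_lemma:
  assumes A: "qcategory Q A" and a: "a \<in> ob A" and \<phi>: "\<phi> \<in> ob (Psh Q A)"
  shows "hm (Psh Q A) (yoneda A a) \<phi> = snd \<phi> a"
proof -
  have y: "yoneda A a \<in> ob (Psh Q A)" using qfunctor_ob[OF qfunctor_yoneda[OF A] a] .
  have fy: "fst (yoneda A a) = ty A a" by (simp add: yoneda_def)
  have sy: "snd (yoneda A a) b = hm A b a" if "b \<in> ob A" for b using that by (simp add: yoneda_def)
  note m = Psh_hom[OF A \<phi> y refl fy] and h = Psh_homD[OF \<phi> a refl refl]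
    and u = unt_hom[OF qcategory_ty[OF A a]] and aa = qcategory_hom[OF A a a refl refl]
  show ?thesis
  proof (rule leq_antisym[OF m h])
    have "unt Q (ty A a) \<cdot> hm (Psh Q A) (yoneda A a) \<phi> \<preceq> snd \<phi> a"
      by (rule leq_trans[OF cmp_mono_left[OF m u aa qcategory_unt[OF A a]] _
            cmp_hom[OF m u] cmp_hom[OF m aa] h])
        (use Psh_hm_cmp[OF A \<phi> y a] sy[OF a] in simp)
    then show "hm (Psh Q A) (yoneda A a) \<phi> \<preceq> snd \<phi> a" using unt_cmp[OF m] by simp
    show "snd \<phi> a \<preceq> hm (Psh Q A) (yoneda A a) \<phi>"
      using h sy Psh_actD[OF \<phi> a] by (intro Psh_hm_greatest[OF A \<phi> y]) (auto simp: fy)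
  qed
qed

lemma fully_faithful_yoneda: "qcategory Q A \<Longrightarrow> fully_faithful Q A (Psh Q A) (yoneda A)"
  by (simp add: fully_faithful_def qfunctor_yoneda yoneda_lemma qfunctor_ob[OF qfunctor_yoneda])
    (simp add: yoneda_def)

text \<open>Minimality: a competitor \<open>K\<close> maps \<open>hm C (G a) c\<close> below
  \<open>hm (Psh Q A) (K (G a)) (K c)\<close>. Since \<open>yoneda A a\<close> is below
  \<open>K (G a)\<close>, this is below \<open>hm (Psh Q A) (yoneda A a) (K c)\<close>, which is
  \<open>snd (K c) a\<close> by the Yoneda lemma.\<close>

lemma is_lan_nerve:
  assumes A: "qcategory Q A" and C: "qcategory Q C" and G: "qfunctor Q A C G"
  shows "is_lan Q A (Psh Q A) C (yoneda A) G (nerve A C G)"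
  unfolding is_lan_def
proof (intro conjI allI impI)
  note P = qcategory_Psh[OF A] and N = qfunctor_nerve[OF assms] and Y = qfunctor_yoneda[OF A]
  show "qfunctor Q C (Psh Q A) (nerve A C G)" by (fact N)
  show "fun_le Q A (Psh Q A) (yoneda A) (nerve A C G \<circ> G)"
    unfolding fun_le_iff[OF A P Y qfunctor_comp[OF A C P G N]]
  proof
    fix a assume a: "a \<in> ob A"
    show "obj_le Q (Psh Q A) (yoneda A a) ((nerve A C G \<circ> G) a)"
      using Psh_obj_le_iff[OF A qfunctor_ob[OF Y a] qfunctor_ob[OF N qfunctor_ob[OF G a]]]
        qfunctor_hm[OF G a] qfunctor_ty[OF G a] by (simp add: yoneda_def nerve_def)
  qed
  fix K assume "qfunctor Q C (Psh Q A) K \<and> fun_le Q A (Psh Q A) (yoneda A) (K \<circ> G)"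
  then have K: "qfunctor Q C (Psh Q A) K" and le: "fun_le Q A (Psh Q A) (yoneda A) (K \<circ> G)" by auto
  show "fun_le Q C (Psh Q A) (nerve A C G) K"
    unfolding fun_le_iff[OF C P N K]
  proof
    fix c assume c: "c \<in> ob C"
    have "hm C (G a) c \<preceq> snd (K c) a" if a: "a \<in> ob A" for a
    proof -
      note Ga = qfunctor_ob[OF G a]
      have "hm (Psh Q A) (K (G a)) (K c) \<preceq> hm (Psh Q A) (yoneda A a) (K c)"
        using hm_mono_left[OF P qfunctor_ob[OF K c]] 
          fun_le_obj_le[OF le A P Y qfunctor_comp[OF A C P G K] a] by simp
      then have 2: "hm (Psh Q A) (K (G a)) (K c) \<preceq> snd (K c) a"
        using yoneda_lemma[OF A a qfunctor_ob[OF K c]] by simp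
      have t: "ty C (G a) = ty A a" "fst (K (G a)) = ty A a" "fst (K c) = ty C c"
        using qfunctor_ty[OF K] qfunctor_ty[OF G] a c Ga by simp_all
      show ?thesis
        by (rule leq_trans[OF qfunctor_hm[OF K c Ga] 2 qcategory_hom[OF C c Ga refl t(1)]
              Psh_hom[OF A qfunctor_ob[OF K c] qfunctor_ob[OF K Ga] t(3,2)]
              Psh_homD[OF qfunctor_ob[OF K c] a t(3) refl]])
    qed
    then show "obj_le Q (Psh Q A) (nerve A C G c) (K c)"
      using Psh_obj_le_iff[OF A qfunctor_ob[OF N c] qfunctor_ob[OF K c]] qfunctor_ty[OF K c]
      by (simp add: nerve_def)
  qed
qed

text \<open>Write \<open>snd (E c) a\<close> as a hom-arrow by the Yoneda lemma, replace
  \<open>yoneda A a\<close> by the isomorphic \<open>E (G a)\<close>, and cancel \<open>E\<close>.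
  Extensionality of columns makes the result an equation of presheaves.\<close>

lemma extension_eq_nerve:
  assumes A: "qcategory Q A" and C: "qcategory Q C" and G: "qfunctor Q A C G"
    and E: "fully_faithful Q C (Psh Q A) E" and iso: "fun_iso Q A (Psh Q A) (yoneda A) (E \<circ> G)"
    and c: "c \<in> ob C"
  shows "E c = nerve A C G c"
proof -
  note P = qcategory_Psh[OF A] and Y = qfunctor_yoneda[OF A] and EF = fully_faithful_qfunctor[OF E]
  note Ec = qfunctor_ob[OF EF c]
  show ?thesis
  proof (rule Psh_eqI[OF Ec nerve_ob[OF A C G c]])
    show "fst (E c) = fst (nerve A C G c)" using qfunctor_ty[OF EF c] by (simp add: nerve_def)
    fix a assume a: "a \<in> ob A"
    have le: "obj_le Q (Psh Q A) (yoneda A a) (E (G a))" "obj_le Q (Psh Q A) (E (G a)) (yoneda A a)"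
      using iso fun_le_obj_le[OF _ A P _ _ a] Y qfunctor_comp[OF A C P G EF]
      by (fastforce simp: fun_iso_def)+
    have "snd (E c) a = hm (Psh Q A) (yoneda A a) (E c)" using yoneda_lemma[OF A a Ec] by simp
    also have "\<dots> = hm (Psh Q A) (E (G a)) (E c)"
      using hm_cong[OF P le] obj_le_refl[OF P Ec] by blast
    also have "\<dots> = hm C (G a) c" using fully_faithful_hm[OF E c qfunctor_ob[OF G a]] by simp
    finally show "snd (E c) a = snd (nerve A C G c) a" using a by (simp add: nerve_def)
  qed
qed


section \<open>Calculus of weighted colimits of presheaves\<close>

context
  fixes X :: "('v, 'o, 'm) qcat" and A :: "('u, 'o, 'm) qcat"
    and g :: "'v \<Rightarrow> ('u, 'o, 'm) presheaf"
  assumes X: "qcategory Q X" and A: "qcategory Q A" and g: "qfunctor Q X (Psh Q A) g"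
begin

lemma diagram_hom:
  assumes "x \<in> ob X" "a \<in> ob A"
  shows "snd (g x) a \<in> hom Q (ty X x) (ty A a)"
  using assms qfunctor_ty[OF g] by (intro Psh_homD[OF qfunctor_ob[OF g]]) auto

lemma wcolim_family:
  assumes "\<Theta> \<in> ob (Psh Q X)" "a \<in> ob A"
  shows "(\<lambda>x. snd (g x) a \<cdot> snd \<Theta> x) ` ob X \<subseteq> hom Q (fst \<Theta>) (ty A a)"
  using cmp_hom[OF Psh_homD[OF assms(1) _ refl refl] diagram_hom[OF _ assms(2)]] by blast

lemma wcolim_hom:
  assumes \<Theta>: "\<Theta> \<in> ob (Psh Q X)" and a: "a \<in> ob A"
  shows "snd (wcolim Q X A g \<Theta>) a \<in> hom Q (fst \<Theta>) (ty A a)"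
  using homSup_hom[OF Psh_objD[OF \<Theta>] qcategory_ty[OF A a] wcolim_family[OF \<Theta> a]] a
  by (simp add: wcolim_def)

lemma wcolim_upper:
  assumes \<Theta>: "\<Theta> \<in> ob (Psh Q X)" and a: "a \<in> ob A" and x: "x \<in> ob X"
  shows "snd (g x) a \<cdot> snd \<Theta> x \<preceq> snd (wcolim Q X A g \<Theta>) a"
  using homSup_upper[OF Psh_objD[OF \<Theta>] qcategory_ty[OF A a] wcolim_family[OF \<Theta> a]] a x
  by (simp add: wcolim_def)

lemma wcolim_least:
  assumes \<Theta>: "\<Theta> \<in> ob (Psh Q X)" and a: "a \<in> ob A" and f: "f \<in> hom Q (fst \<Theta>) (ty A a)"
    and le: "\<And>x. x \<in> ob X \<Longrightarrow> snd (g x) a \<cdot> snd \<Theta> x \<preceq> f"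
  shows "snd (wcolim Q X A g \<Theta>) a \<preceq> f"
  using homSup_least[OF Psh_objD[OF \<Theta>] qcategory_ty[OF A a] wcolim_family[OF \<Theta> a] f] a le
  by (auto simp: wcolim_def)

text \<open>Precomposition with \<open>h\<close> distributes over the supremum, so it suffices to
  bound each reassociated term. The next lemma does the same for postcomposition.\<close>

lemma wcolim_cmp_least:
  assumes \<Theta>: "\<Theta> \<in> ob (Psh Q X)" and a: "a \<in> ob A" and f: "f \<in> hom Q W (ty A a)"
    and h: "h \<in> hom Q W (fst \<Theta>)"
    and le: "\<And>x. x \<in> ob X \<Longrightarrow> snd (g x) a \<cdot> (snd \<Theta> x \<cdot> h) \<preceq> f"
  shows "snd (wcolim Q X A g \<Theta>) a \<cdot> h \<preceq> f"
proof -
  have as: "(snd (g x) a \<cdot> snd \<Theta> x) \<cdot> h = snd (g x) a \<cdot> (snd \<Theta> x \<cdot> h)" if x: "x \<in> ob X" for x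
    by (rule cmp_assoc[OF h Psh_homD[OF \<Theta> x refl refl] diagram_hom[OF x a]])
  have "snd (wcolim Q X A g \<Theta>) a \<cdot> h =
      homSup Q W (ty A a) ((\<lambda>f. f \<cdot> h) ` (\<lambda>x. snd (g x) a \<cdot> snd \<Theta> x) ` ob X)"
    using Sup_cmp[OF qcategory_ty[OF A a] h wcolim_family[OF \<Theta> a]] a by (simp add: wcolim_def)
  also have "\<dots> \<preceq> f"
  proof (rule homSup_least[OF hom_obj[OF f] _ f])
    show "(\<lambda>f. f \<cdot> h) ` (\<lambda>x. snd (g x) a \<cdot> snd \<Theta> x) ` ob X \<subseteq> hom Q W (ty A a)"
      using wcolim_family[OF \<Theta> a] cmp_hom[OF h] by blast
  qed (use as le in auto)
  finally show ?thesis .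
qed

lemma cmp_wcolim_least:
  assumes \<Theta>: "\<Theta> \<in> ob (Psh Q X)" and a: "a \<in> ob A" and f: "f \<in> hom Q (fst \<Theta>) Z"
    and h: "h \<in> hom Q (ty A a) Z"
    and le: "\<And>x. x \<in> ob X \<Longrightarrow> (h \<cdot> snd (g x) a) \<cdot> snd \<Theta> x \<preceq> f"
  shows "h \<cdot> snd (wcolim Q X A g \<Theta>) a \<preceq> f"
proof -
  have as: "h \<cdot> (snd (g x) a \<cdot> snd \<Theta> x) = (h \<cdot> snd (g x) a) \<cdot> snd \<Theta> x" if x: "x \<in> ob X" for x
    by (rule cmp_assoc[OF Psh_homD[OF \<Theta> x refl refl] diagram_hom[OF x a] h, symmetric])
  have "h \<cdot> snd (wcolim Q X A g \<Theta>) a =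
      homSup Q (fst \<Theta>) Z ((\<lambda>f. h \<cdot> f) ` (\<lambda>x. snd (g x) a \<cdot> snd \<Theta> x) ` ob X)"
    using cmp_Sup[OF Psh_objD[OF \<Theta>] wcolim_family[OF \<Theta> a] h] a by (simp add: wcolim_def)
  also have "\<dots> \<preceq> f"
  proof (rule homSup_least[OF hom_obj[OF f] _ f])
    show "(\<lambda>f. h \<cdot> f) ` (\<lambda>x. snd (g x) a \<cdot> snd \<Theta> x) ` ob X \<subseteq> hom Q (fst \<Theta>) Z"
      using wcolim_family[OF \<Theta> a] cmp_hom[OF _ h] by blast
  qed (use as le in auto)
  finally show ?thesis .
qed

lemma wcolim_ob:
  assumes \<Theta>: "\<Theta> \<in> ob (Psh Q X)"
  shows "wcolim Q X A g \<Theta> \<in> ob (Psh Q A)"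
  unfolding Psh_ob_iff
proof (intro conjI ballI)
  show "fst (wcolim Q X A g \<Theta>) \<in> obj Q" "snd (wcolim Q X A g \<Theta>) \<in> extensional (ob A)"
    using Psh_objD[OF \<Theta>] by (auto simp: wcolim_def)
  show "snd (wcolim Q X A g \<Theta>) a \<in> hom Q (fst (wcolim Q X A g \<Theta>)) (ty A a)" if "a \<in> ob A" for a
    using wcolim_hom[OF \<Theta> that] by (simp add: wcolim_def)
  fix a b assume a: "a \<in> ob A" and b: "b \<in> ob A"
  note h = qcategory_hom[OF A a b refl refl]
  show "hm A b a \<cdot> snd (wcolim Q X A g \<Theta>) a \<preceq> snd (wcolim Q X A g \<Theta>) b"
  proof (rule cmp_wcolim_least[OF \<Theta> a wcolim_hom[OF \<Theta> b] h])
    fix x assume x: "x \<in> ob X"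
    note \<Theta>x = Psh_homD[OF \<Theta> x refl refl] and gx = diagram_hom[OF x a] diagram_hom[OF x b]
    show "(hm A b a \<cdot> snd (g x) a) \<cdot> snd \<Theta> x \<preceq> snd (wcolim Q X A g \<Theta>) b"
      by (rule leq_trans[OF cmp_mono_left[OF \<Theta>x cmp_hom[OF gx(1) h] gx(2)
              Psh_actD[OF qfunctor_ob[OF g x] a b]] wcolim_upper[OF \<Theta> b x]
            cmp_hom[OF \<Theta>x cmp_hom[OF gx(1) h]] cmp_hom[OF \<Theta>x gx(2)] wcolim_hom[OF \<Theta> b]])
  qed
qed

lemma qfunctor_wcolim: "qfunctor Q (Psh Q X) (Psh Q A) (wcolim Q X A g)"
  unfolding qfunctor_def ty_Psh
proof (intro conjI ballI)
  show "wcolim Q X A g \<in> ob (Psh Q X) \<rightarrow> ob (Psh Q A)" using wcolim_ob by blast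
  show "fst (wcolim Q X A g \<Theta>) = fst \<Theta>" for \<Theta> by (simp add: wcolim_def)
next
  fix \<Theta> \<Theta>' assume \<Theta>: "\<Theta> \<in> ob (Psh Q X)" and \<Theta>': "\<Theta>' \<in> ob (Psh Q X)"
  note h = Psh_hom[OF X \<Theta> \<Theta>' refl refl]
  show "hm (Psh Q X) \<Theta>' \<Theta> \<preceq> hm (Psh Q A) (wcolim Q X A g \<Theta>') (wcolim Q X A g \<Theta>)"
  proof (rule Psh_hm_greatest[OF A wcolim_ob[OF \<Theta>] wcolim_ob[OF \<Theta>']])
    show "hm (Psh Q X) \<Theta>' \<Theta> \<in> hom Q (fst (wcolim Q X A g \<Theta>)) (fst (wcolim Q X A g \<Theta>'))"
      using h by (simp add: wcolim_def)
    fix a assume a: "a \<in> ob A"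
    show "snd (wcolim Q X A g \<Theta>') a \<cdot> hm (Psh Q X) \<Theta>' \<Theta> \<preceq> snd (wcolim Q X A g \<Theta>) a"
    proof (rule wcolim_cmp_least[OF \<Theta>' a wcolim_hom[OF \<Theta> a] h])
      fix x assume x: "x \<in> ob X"
      note hx = Psh_homD[OF \<Theta> x refl refl] cmp_hom[OF h Psh_homD[OF \<Theta>' x refl refl]]
        and gx = diagram_hom[OF x a]
      show "snd (g x) a \<cdot> (snd \<Theta>' x \<cdot> hm (Psh Q X) \<Theta>' \<Theta>) \<preceq> snd (wcolim Q X A g \<Theta>) a"
        by (rule leq_trans[OF cmp_mono_right[OF hx(2,1) gx Psh_hm_cmp[OF X \<Theta> \<Theta>' x]]
              wcolim_upper[OF \<Theta> a x] cmp_hom[OF hx(2) gx] cmp_hom[OF hx(1) gx] wcolim_hom[OF \<Theta> a]])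
    qed
  qed
qed

text \<open>The co-Yoneda lemma. \<open>g\<close> maps \<open>hm X y x\<close> below
  \<open>hm (Psh Q A) (g y) (g x)\<close>, which bounds the term at \<open>y\<close> by
  \<open>snd (g x) a\<close>; the term at \<open>x\<close> attains this bound by the identity below
  \<open>hm X x x\<close>.\<close>

lemma wcolim_yoneda:
  assumes x: "x \<in> ob X"
  shows "wcolim Q X A g (yoneda X x) = g x"
proof -
  have Y: "yoneda X x \<in> ob (Psh Q X)" using qfunctor_ob[OF qfunctor_yoneda[OF X] x] .
  have fY: "fst (yoneda X x) = ty X x" and sY: "\<And>y. y \<in> ob X \<Longrightarrow> snd (yoneda X x) y = hm X y x"
    by (simp_all add: yoneda_def)
  show ?thesis
  proof (rule Psh_eqI[OF wcolim_ob[OF Y] qfunctor_ob[OF g x]])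
    show "fst (wcolim Q X A g (yoneda X x)) = fst (g x)"
      using qfunctor_ty[OF g x] by (simp add: wcolim_def fY)
    fix a assume a: "a \<in> ob A"
    note W = wcolim_hom[OF Y a, unfolded fY] and gx = diagram_hom[OF x a]
      and u = unt_hom[OF qcategory_ty[OF X x]] and xx = qcategory_hom[OF X x x refl refl]
    have "snd (g y) a \<cdot> snd (yoneda X x) y \<preceq> snd (g x) a" if y: "y \<in> ob X" for y
    proof -
      note h = qcategory_hom[OF X x y refl refl] and gy = diagram_hom[OF y a]
      have p: "hm (Psh Q A) (g y) (g x) \<in> hom Q (ty X x) (ty X y)"
        using Psh_hom[OF A qfunctor_ob[OF g x] qfunctor_ob[OF g y]]
          qfunctor_ty[OF g x] qfunctor_ty[OF g y] by simp
      show ?thesis unfolding sY[OF y]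
        by (rule leq_trans[OF cmp_mono_right[OF h p gy qfunctor_hm[OF g x y]]
              Psh_hm_cmp[OF A qfunctor_ob[OF g x] qfunctor_ob[OF g y] a]
              cmp_hom[OF h gy] cmp_hom[OF p gy] gx])
    qed
    then have "snd (wcolim Q X A g (yoneda X x)) a \<preceq> snd (g x) a"
      using gx by (intro wcolim_least[OF Y a]) (auto simp: fY)
    moreover have "snd (g x) a \<preceq> snd (wcolim Q X A g (yoneda X x)) a"
    proof -
      have "snd (g x) a \<cdot> unt Q (ty X x) \<preceq> snd (wcolim Q X A g (yoneda X x)) a"
        by (rule leq_trans[OF cmp_mono_right[OF u xx gx qcategory_unt[OF X x]]
              wcolim_upper[OF Y a x, unfolded sY[OF x]] cmp_hom[OF u gx] cmp_hom[OF xx gx] W])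
      then show ?thesis using cmp_unt[OF gx] by simp
    qed
    ultimately show "snd (wcolim Q X A g (yoneda X x)) a = snd (g x) a"
      by (rule leq_antisym[OF W gx])
  qed
qed

end

section \<open>The structure maps of the presheaf monad as weighted colimits\<close>

lemma qfunctor_Psh_mult: "qcategory Q A \<Longrightarrow> qfunctor Q (Psh Q (Psh Q A)) (Psh Q A) (Psh_mult Q A)"
  unfolding Psh_mult_eq_wcolim by (intro qfunctor_wcolim qfunctor_id qcategory_Psh)

lemma qfunctor_Psh_map:
  "\<lbrakk>qcategory Q A; qcategory Q B; qfunctor Q A B F\<rbrakk>
    \<Longrightarrow> qfunctor Q (Psh Q A) (Psh Q B) (Psh_map Q A B F)"
  unfolding Psh_map_eq_wcolim
  by (intro qfunctor_wcolim qfunctor_comp[where B = B] qfunctor_yoneda qcategory_Psh)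

lemma Psh_map_yoneda:
  "\<lbrakk>qcategory Q A; qcategory Q B; qfunctor Q A B F; a \<in> ob A\<rbrakk>
    \<Longrightarrow> Psh_map Q A B F (yoneda A a) = yoneda B (F a)"
  unfolding Psh_map_eq_wcolim
  by (subst wcolim_yoneda) (auto intro: qfunctor_comp[where B = B] qfunctor_yoneda qcategory_Psh)

lemma Psh_mult_yoneda:
  "\<lbrakk>qcategory Q A; \<phi> \<in> ob (Psh Q A)\<rbrakk> \<Longrightarrow> Psh_mult Q A (yoneda (Psh Q A) \<phi>) = \<phi>"
  unfolding Psh_mult_eq_wcolim
  by (subst wcolim_yoneda) (auto intro: qfunctor_id qcategory_Psh)

text \<open>Expanding the left side gives terms \<open>snd \<phi> a \<cdot> hm (Psh Q A) \<phi> (g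
  x) \<cdot> snd \<Theta> x\<close>. The first two factors are bounded by
  \<open>snd (g x) a\<close>, which leaves a term of the colimit.\<close>

lemma Psh_mult_Psh_map_le:
  assumes X: "qcategory Q X" and A: "qcategory Q A" and g: "qfunctor Q X (Psh Q A) g"
    and \<Theta>: "\<Theta> \<in> ob (Psh Q X)"
  shows "obj_le Q (Psh Q A) (Psh_mult Q A (Psh_map Q X (Psh Q A) g \<Theta>)) (wcolim Q X A g \<Theta>)"
proof -
  note P = qcategory_Psh[OF A] and I = qfunctor_id[OF qcategory_Psh[OF A]]
  define \<Theta>' where "\<Theta>' = Psh_map Q X (Psh Q A) g \<Theta>"
  have Yg: "qfunctor Q X (Psh Q (Psh Q A)) (yoneda (Psh Q A) \<circ> g)"
    by (rule qfunctor_comp[OF X P qcategory_Psh[OF P] g qfunctor_yoneda[OF P]])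
  have \<Theta>': "\<Theta>' \<in> ob (Psh Q (Psh Q A))"
    unfolding \<Theta>'_def using qfunctor_ob[OF qfunctor_Psh_map[OF X P g] \<Theta>] .
  have f: "fst \<Theta>' = fst \<Theta>" by (simp add: \<Theta>'_def Psh_map_def)
  have "snd (Psh_mult Q A \<Theta>') a \<preceq> snd (wcolim Q X A g \<Theta>) a" if a: "a \<in> ob A" for a
    unfolding Psh_mult_eq_wcolim
  proof (rule wcolim_least[OF P A I \<Theta>' a])
    note W = wcolim_hom[OF X A g \<Theta> a]
    show "snd (wcolim Q X A g \<Theta>) a \<in> hom Q (fst \<Theta>') (ty A a)" using W f by simp
    fix \<phi> assume \<phi>: "\<phi> \<in> ob (Psh Q A)"
    note \<phi>a = Psh_homD[OF \<phi> a refl refl]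
    show "snd (id \<phi>) a \<cdot> snd \<Theta>' \<phi> \<preceq> snd (wcolim Q X A g \<Theta>) a"
      unfolding \<Theta>'_def Psh_map_eq_wcolim id_apply
    proof (rule cmp_wcolim_least[OF X P Yg \<Theta> \<phi> W])
      show "snd \<phi> a \<in> hom Q (ty (Psh Q A) \<phi>) (ty A a)" using \<phi>a by simp
      fix x assume x: "x \<in> ob X"
      note gx = qfunctor_ob[OF g x] and \<Theta>x = Psh_homD[OF \<Theta> x refl refl]
      have fg: "fst (g x) = ty X x" using qfunctor_ty[OF g x] by simp
      note p = Psh_hom[OF A gx \<phi> fg refl] and ga = Psh_homD[OF gx a fg refl]
      have s: "snd ((yoneda (Psh Q A) \<circ> g) x) \<phi> = hm (Psh Q A) \<phi> (g x)"
        using \<phi> by (simp add: yoneda_def)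
      show "(snd \<phi> a \<cdot> snd ((yoneda (Psh Q A) \<circ> g) x) \<phi>) \<cdot> snd \<Theta> x \<preceq> snd (wcolim Q X A g \<Theta>) a"
        unfolding s
        by (rule leq_trans[OF cmp_mono_left[OF \<Theta>x cmp_hom[OF p \<phi>a] ga Psh_hm_cmp[OF A gx \<phi> a]]
              wcolim_upper[OF X A g \<Theta> a x] cmp_hom[OF \<Theta>x cmp_hom[OF p \<phi>a]] cmp_hom[OF \<Theta>x ga] W])
    qed
  qed
  then show ?thesis
    using Psh_obj_le_iff[OF A qfunctor_ob[OF qfunctor_Psh_mult[OF A] \<Theta>'] wcolim_ob[OF X A g \<Theta>]] f
    by (simp add: \<Theta>'_def wcolim_def Psh_mult_def)
qed

end


section \<open>Smallness of presheaf categories\<close>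

lemma small_lepoll:
  assumes U: "universe U" and Y: "small U Y" and le: "X \<lesssim> Y"
  shows "small U X"
proof -
  obtain S where S: "S \<in> U" "Y \<approx> S" using Y by (auto simp: small_def)
  then have "X \<lesssim> S" using le lepoll_trans2 by blast
  then obtain f where f: "inj_on f X" "f ` X \<subseteq> S" by (auto simp: lepoll_def)
  then have "f ` X \<in> U" using U S(1) by (auto simp: universe_def)
  moreover have "X \<approx> f ` X" using f(1) eqpoll_sym inj_on_image_eqpoll_self by blast
  ultimately show ?thesis by (auto simp: small_def)
qed

lemma small_Times:
  assumes U: "universe U" and X: "small U X" and Y: "small U Y"
  shows "small U (X \<times> Y)"
proof -
  obtain S S' where S: "S \<in> U" "X \<approx> S" "S' \<in> U" "Y \<approx> S'" using X Y by (auto simp: small_def)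
  obtain P where "P \<in> U" "S \<times> S' \<approx> P" using U S unfolding universe_def by meson
  then show ?thesis using times_eqpoll_cong[OF S(2,4)] eqpoll_trans by (auto simp: small_def)
qed

lemma small_Pow:
  assumes U: "universe U" and X: "small U X"
  shows "small U (Pow X)"
proof -
  obtain S where S: "S \<in> U" "X \<approx> S" using X by (auto simp: small_def)
  obtain P where P: "P \<in> U" "Pow S \<approx> P" using U S unfolding universe_def by meson
  obtain f where "bij_betw f X S" using S by (auto simp: eqpoll_def)
  then have "Pow X \<approx> Pow S" using bij_betw_Pow by (auto simp: eqpoll_def)
  then show ?thesis using P eqpoll_trans by (auto simp: small_def)
qed

text \<open>A presheaf is determined by its type and the graph of its column on \<open>ob A\<close>;
  extensionality makes this encoding injective.\<close>

lemma (in quantaloid) small_Psh: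
  assumes U: "universe U" and Q: "small_quantaloid U Q" and A: "A \<in> QCat Q U"
  shows "small U (ob (Psh Q A))"
proof (rule small_lepoll[OF U])
  have "small U (ob A)" using A by (auto simp: QCat_def small_def)
  then show "small U (obj Q \<times> Pow (ob A \<times> arr Q))"
    using U Q by (intro small_Times small_Pow) (auto simp: small_quantaloid_def)
  let ?graph = "\<lambda>\<phi>. (fst \<phi>, (\<lambda>a. (a, snd \<phi> a)) ` ob A)"
  have "inj_on ?graph (ob (Psh Q A))"
    by (rule inj_onI, rule Psh_eqI) auto
  moreover have "?graph ` ob (Psh Q A) \<subseteq> obj Q \<times> Pow (ob A \<times> arr Q)"
    by (auto simp: Psh_ob_iff hom_def)
  ultimately show "ob (Psh Q A) \<lesssim> obj Q \<times> Pow (ob A \<times> arr Q)"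
    unfolding lepoll_def by blast
qed

text \<open>\<open>T\<close> acts on categories whose objects form a member of \<open>U\<close>,
  whereas presheaf categories live on another type. Transport along a bijection makes
  \<open>T\<close> applicable to them.\<close>

lemma (in quantaloid) small_copy:
  fixes P :: "('v, 'o, 'm) qcat" and U :: "'u set set"
  assumes P: "qcategory Q P" and small: "small U (ob P)"
  obtains X :: "('u, 'o, 'm) qcat" and g h where "X \<in> QCat Q U" "qfunctor Q X P g" "qfunctor Q P X h"
    "\<And>x. x \<in> ob X \<Longrightarrow> h (g x) = x" "\<And>p. p \<in> ob P \<Longrightarrow> g (h p) = p"
proof -
  obtain S where S: "S \<in> U" "ob P \<approx> S" using small by (auto simp: small_def)
  then obtain g where g: "bij_betw g S (ob P)" using eqpoll_sym by (metis eqpoll_def)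
  define h where "h = inv_into S g"
  have gh: "g (h p) = p" "h p \<in> S" if "p \<in> ob P" for p
    using that g bij_betw_inv_into_right bij_betwE[OF bij_betw_inv_into] by (fastforce simp: h_def)+
  have hg: "h (g x) = x" "g x \<in> ob P" if "x \<in> S" for x
    using that g bij_betw_inv_into_left bij_betwE by (fastforce simp: h_def)+
  define X where "X = \<lparr>ob = S, ty = ty P \<circ> g, hm = (\<lambda>x y. hm P (g x) (g y))\<rparr>"
  show thesis
  proof
    show "X \<in> QCat Q U"
      using S P hg by (auto simp: QCat_def qcategory_def X_def)
    show "qfunctor Q X P g" "qfunctor Q P X h"
      using P hg gh by (auto simp: qfunctor_def X_def qcategory_def intro!: leq_refl[OF qcategory_hom[OF P _ _ refl refl]])
  qed (use hg gh in \<open>auto simp: X_def\<close>)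
qed


section \<open>Algebras and the nerve of a KZ-doctrine\<close>

locale quantaloid_KZ_doctrine = quantaloid Q + KZ_doctrine Q U T Tm \<mu> \<eta>
  for Q :: "('o, 'm) quantaloid" (structure) and U :: "'u set set" and T Tm \<mu> \<eta>
begin

section \<open>Pointwise forms of the 2-monad laws and of the KZ-inequality\<close>

lemma QCat_qcategory: "A \<in> QCat Q U \<Longrightarrow> qcategory Q A"
  by (simp add: QCat_def)

lemma T_qcategory: "A \<in> QCat Q U \<Longrightarrow> qcategory Q (T A)"
  by (simp add: QCat_qcategory T_ob)

lemma Tm_obj_le:
  assumes A: "A \<in> QCat Q U" and B: "B \<in> QCat Q U" and F: "qfunctor Q A B F" and G: "qfunctor Q A B G"
    and le: "\<And>a. a \<in> ob A \<Longrightarrow> obj_le Q B (F a) (G a)" and t: "t \<in> ob (T A)"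
  shows "obj_le Q (T B) (Tm A B F t) (Tm A B G t)"
proof (rule fun_le_obj_le[OF Tm_mono[OF A B F G]])
  show "fun_le Q A B F G" using fun_le_iff[OF QCat_qcategory[OF A] QCat_qcategory[OF B] F G] le by blast
qed (use A B F G t in \<open>auto intro: T_qcategory Tm_functor\<close>)

lemma fun_iso_obj_le:
  assumes "fun_iso Q A B F G" "qcategory Q A" "qcategory Q B" "qfunctor Q A B F" "qfunctor Q A B G" "a \<in> ob A"
  shows "obj_le Q B (F a) (G a)" "obj_le Q B (G a) (F a)"
  using assms fun_le_obj_le unfolding fun_iso_def by fast+

lemma Tm_id_obj_le:
  assumes "A \<in> QCat Q U" "t \<in> ob (T A)"
  shows "obj_le Q (T A) t (Tm A A id t)"
  using fun_iso_obj_le(2)[OF Tm_id[OF assms(1)]] assms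
  by (simp add: T_qcategory Tm_functor qfunctor_id QCat_qcategory)

lemma Tm_comp_obj_le:
  assumes A: "A \<in> QCat Q U" and B: "B \<in> QCat Q U" and C: "C \<in> QCat Q U"
    and F: "qfunctor Q A B F" and G: "qfunctor Q B C G" and t: "t \<in> ob (T A)"
  shows "obj_le Q (T C) (Tm A C (G \<circ> F) t) (Tm B C G (Tm A B F t))"
    "obj_le Q (T C) (Tm B C G (Tm A B F t)) (Tm A C (G \<circ> F) t)"
proof -
  note q = T_qcategory[OF A] T_qcategory[OF B] T_qcategory[OF C]
  note f = Tm_functor[OF A C qfunctor_comp[OF QCat_qcategory[OF A] QCat_qcategory[OF B] QCat_qcategory[OF C] F G]]
    qfunctor_comp[OF q Tm_functor[OF A B F] Tm_functor[OF B C G]]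
  show "obj_le Q (T C) (Tm A C (G \<circ> F) t) (Tm B C G (Tm A B F t))"
    "obj_le Q (T C) (Tm B C G (Tm A B F t)) (Tm A C (G \<circ> F) t)"
    using fun_iso_obj_le[OF Tm_comp[OF A B C F G] q(1,3) f t] by simp_all
qed

lemma \<eta>_natural_obj_le:
  assumes A: "A \<in> QCat Q U" and B: "B \<in> QCat Q U" and F: "qfunctor Q A B F" and a: "a \<in> ob A"
  shows "obj_le Q (T B) (\<eta> B (F a)) (Tm A B F (\<eta> A a))"
    "obj_le Q (T B) (Tm A B F (\<eta> A a)) (\<eta> B (F a))"
proof -
  note q = QCat_qcategory[OF A] QCat_qcategory[OF B] T_qcategory[OF A] T_qcategory[OF B]
  note f = qfunctor_comp[OF q(1,2,4) F \<eta>_functor[OF B]] qfunctor_comp[OF q(1,3,4) \<eta>_functor[OF A] Tm_functor[OF A B F]]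
  show "obj_le Q (T B) (\<eta> B (F a)) (Tm A B F (\<eta> A a))"
    "obj_le Q (T B) (Tm A B F (\<eta> A a)) (\<eta> B (F a))"
    using fun_iso_obj_le[OF \<eta>_natural[OF A B F] q(1,4) f a] by simp_all
qed

lemma \<mu>_natural_obj_le:
  assumes A: "A \<in> QCat Q U" and B: "B \<in> QCat Q U" and F: "qfunctor Q A B F" and s: "s \<in> ob (T (T A))"
  shows "obj_le Q (T B) (Tm A B F (\<mu> A s)) (\<mu> B (Tm (T A) (T B) (Tm A B F) s))"
proof -
  note TA = T_ob[OF A] and TB = T_ob[OF B] and TF = Tm_functor[OF A B F]
  note q = T_qcategory[OF A] T_qcategory[OF B] T_qcategory[OF TA] T_qcategory[OF TB]
  note f = qfunctor_comp[OF q(3,4,2) Tm_functor[OF TA TB TF] \<mu>_functor[OF B]]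
    qfunctor_comp[OF q(3,1,2) \<mu>_functor[OF A] TF]
  show ?thesis using fun_iso_obj_le(2)[OF \<mu>_natural[OF A B F] q(3,2) f s] by simp
qed

lemma \<mu>_\<eta>_obj_le:
  assumes A: "A \<in> QCat Q U" and t: "t \<in> ob (T A)"
  shows "obj_le Q (T A) t (\<mu> A (\<eta> (T A) t))"
proof -
  note TA = T_ob[OF A] and q = T_qcategory[OF A] T_qcategory[OF T_ob[OF A]]
  note f = qfunctor_comp[OF q(1,2,1) \<eta>_functor[OF TA] \<mu>_functor[OF A]] qfunctor_id[OF q(1)]
  show ?thesis using fun_iso_obj_le(2)[OF \<mu>_\<eta>T[OF A] q(1,1) f t] by simp
qed

lemma \<mu>_T\<eta>_obj_le:
  assumes A: "A \<in> QCat Q U" and t: "t \<in> ob (T A)"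
  shows "obj_le Q (T A) (\<mu> A (Tm A (T A) (\<eta> A) t)) t"
proof -
  note TA = T_ob[OF A] and q = T_qcategory[OF A] T_qcategory[OF T_ob[OF A]]
  note f = qfunctor_comp[OF q(1,2,1) Tm_functor[OF A TA \<eta>_functor[OF A]] \<mu>_functor[OF A]]
    qfunctor_id[OF q(1)]
  show ?thesis using fun_iso_obj_le(1)[OF \<mu>_T\<eta>[OF A] q(1,1) f t] by simp
qed

lemma KZ_obj_le:
  assumes A: "A \<in> QCat Q U" and t: "t \<in> ob (T A)"
  shows "obj_le Q (T (T A)) (Tm A (T A) (\<eta> A) t) (\<eta> (T A) t)"
  using fun_le_obj_le[OF KZ[OF A] T_qcategory[OF A] T_qcategory[OF T_ob[OF A]]
      Tm_functor[OF A T_ob[OF A] \<eta>_functor[OF A]] \<eta>_functor[OF T_ob[OF A]] t] .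

section \<open>Retractions of the unit\<close>

context
  fixes X \<alpha>
  assumes X: "X \<in> QCat Q U" and \<alpha>: "qfunctor Q (T X) X \<alpha>"
    and \<alpha>_\<eta>: "\<And>x. x \<in> ob X \<Longrightarrow> \<alpha> (\<eta> X x) = x"
begin

text \<open>By the KZ-inequality a retraction of \<open>\<eta> X\<close> is automatically left adjoint to \<open>\<eta> X\<close>, and then
  an algebra structure.\<close>

lemma retraction_adjoint:
  assumes t: "t \<in> ob (T X)"
  shows "obj_le Q (T X) t (\<eta> X (\<alpha> t))"
proof -
  note cX = QCat_qcategory[OF X] and cTX = T_qcategory[OF X] and TX = T_ob[OF X]
    and \<eta>X = \<eta>_functor[OF X] and tr = obj_le_trans[OF T_qcategory[OF X]]
  note T\<alpha> = Tm_functor[OF TX X \<alpha>]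
  have "obj_le Q (T X) t (Tm X X id t)" by (rule Tm_id_obj_le[OF X t])
  also have "obj_le Q (T X) (Tm X X id t) (Tm X X (\<alpha> \<circ> \<eta> X) t)"
    by (rule Tm_obj_le[OF X X qfunctor_id[OF cX] qfunctor_comp[OF cX cTX cX \<eta>X \<alpha>] _ t])
      (simp add: \<alpha>_\<eta> obj_le_refl[OF cX])
  also (tr) have "obj_le Q (T X) (Tm X X (\<alpha> \<circ> \<eta> X) t) (Tm (T X) X \<alpha> (Tm X (T X) (\<eta> X) t))"
    by (rule Tm_comp_obj_le(1)[OF X TX X \<eta>X \<alpha> t])
  \<comment> \<open>This link is the KZ-inequality; the others are functoriality of
    \<open>T\<close>, the retraction equation and naturality of \<open>\<eta>\<close>.\<close>
  also (tr) have "obj_le Q (T X) (Tm (T X) X \<alpha> (Tm X (T X) (\<eta> X) t)) (Tm (T X) X \<alpha> (\<eta> (T X) t))"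
    by (rule qfunctor_obj_le[OF T_qcategory[OF TX] cTX T\<alpha> KZ_obj_le[OF X t]])
  also (tr) have "obj_le Q (T X) (Tm (T X) X \<alpha> (\<eta> (T X) t)) (\<eta> X (\<alpha> t))"
    by (rule \<eta>_natural_obj_le(2)[OF TX X \<alpha> t])
  finally (tr) show ?thesis .
qed

text \<open>Write \<open>T F\<close> for the action of \<open>Tm\<close>. Monotonicity bounds
  \<open>T H\<close> by \<open>T K \<circ> T (\<eta> A)\<close>, the KZ-inequality replaces
  \<open>T (\<eta> A)\<close> by \<open>\<eta> (T A)\<close>, and naturality turns the result into
  \<open>\<eta> X \<circ> K\<close>. Applying \<open>\<alpha>\<close> removes
  \<open>\<eta> X\<close>.\<close>

lemma retraction_extension_least:
  assumes A: "A \<in> QCat Q U" and H: "qfunctor Q A X H" and K: "qfunctor Q (T A) X K"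
    and le: "\<And>a. a \<in> ob A \<Longrightarrow> obj_le Q X (H a) (K (\<eta> A a))" and t: "t \<in> ob (T A)"
  shows "obj_le Q X (\<alpha> (Tm A X H t)) (K t)"
proof -
  note cX = QCat_qcategory[OF X] and cTX = T_qcategory[OF X] and cA = QCat_qcategory[OF A]
    and TA = T_ob[OF A] and cTA = T_qcategory[OF A] and \<eta>A = \<eta>_functor[OF A]
    and tr = obj_le_trans[OF T_qcategory[OF X]]
  have "obj_le Q (T X) (Tm A X H t) (Tm A X (K \<circ> \<eta> A) t)"
    by (rule Tm_obj_le[OF A X H qfunctor_comp[OF cA cTA cX \<eta>A K] _ t]) (simp add: le)
  also have "obj_le Q (T X) (Tm A X (K \<circ> \<eta> A) t) (Tm (T A) X K (Tm A (T A) (\<eta> A) t))"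
    by (rule Tm_comp_obj_le(1)[OF A TA X \<eta>A K t])
  also (tr) have "obj_le Q (T X) (Tm (T A) X K (Tm A (T A) (\<eta> A) t)) (Tm (T A) X K (\<eta> (T A) t))"
    by (rule qfunctor_obj_le[OF T_qcategory[OF TA] cTX Tm_functor[OF TA X K] KZ_obj_le[OF A t]])
  also (tr) have "obj_le Q (T X) (Tm (T A) X K (\<eta> (T A) t)) (\<eta> X (K t))"
    by (rule \<eta>_natural_obj_le(2)[OF TA X K t])
  finally (tr) have "obj_le Q X (\<alpha> (Tm A X H t)) (\<alpha> (\<eta> X (K t)))"
    by (rule qfunctor_obj_le[OF cTX cX \<alpha>])
  then show ?thesis using \<alpha>_\<eta>[OF qfunctor_ob[OF K t]] by simp
qed

text \<open>Half of the associativity law of an algebra. The identity lies below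
  \<open>\<eta> X \<circ> \<alpha>\<close>; apply \<open>T\<close> and then \<open>\<mu> X\<close>,
  and cancel \<open>T (\<eta> X)\<close> by the unit law.\<close>

lemma retraction_mult:
  assumes s: "s \<in> ob (T (T X))"
  shows "obj_le Q X (\<alpha> (\<mu> X s)) (\<alpha> (Tm (T X) X \<alpha> s))"
proof -
  note cX = QCat_qcategory[OF X] and cTX = T_qcategory[OF X] and TX = T_ob[OF X]
    and \<eta>X = \<eta>_functor[OF X] and tr = obj_le_trans[OF T_qcategory[OF T_ob[OF X]]]
    and cTTX = T_qcategory[OF T_ob[OF X]]
  have T\<alpha>s: "Tm (T X) X \<alpha> s \<in> ob (T X)" using qfunctor_ob[OF Tm_functor[OF TX X \<alpha>] s] .
  have "obj_le Q (T (T X)) s (Tm (T X) (T X) id s)" by (rule Tm_id_obj_le[OF TX s])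
  also have "obj_le Q (T (T X)) (Tm (T X) (T X) id s) (Tm (T X) (T X) (\<eta> X \<circ> \<alpha>) s)"
    by (rule Tm_obj_le[OF TX TX qfunctor_id[OF cTX] qfunctor_comp[OF cTX cX cTX \<alpha> \<eta>X] _ s])
      (simp add: retraction_adjoint)
  also (tr) have "obj_le Q (T (T X)) (Tm (T X) (T X) (\<eta> X \<circ> \<alpha>) s) (Tm X (T X) (\<eta> X) (Tm (T X) X \<alpha> s))"
    by (rule Tm_comp_obj_le(1)[OF TX X TX \<alpha> \<eta>X s])
  finally (tr) have "obj_le Q (T X) (\<mu> X s) (\<mu> X (Tm X (T X) (\<eta> X) (Tm (T X) X \<alpha> s)))"
    by (rule qfunctor_obj_le[OF cTTX cTX \<mu>_functor[OF X]])
  then have "obj_le Q (T X) (\<mu> X s) (Tm (T X) X \<alpha> s)"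
    using \<mu>_T\<eta>_obj_le[OF X T\<alpha>s] obj_le_trans[OF cTX] by blast
  then show ?thesis by (rule qfunctor_obj_le[OF cTX cX \<alpha>])
qed

end

section \<open>The nerve of the unit and its entrywise inequalities\<close>

abbreviation N :: "('u, 'o, 'm) qcat \<Rightarrow> 'u \<Rightarrow> ('u, 'o, 'm) presheaf" where
  "N A \<equiv> nerve A (T A) (\<eta> A)"

lemma qfunctor_N: "A \<in> QCat Q U \<Longrightarrow> qfunctor Q (T A) (Psh Q A) (N A)"
  by (intro qfunctor_nerve QCat_qcategory T_qcategory \<eta>_functor)

text \<open>\<open>\<eta> B\<close> maps \<open>hm B b (F a)\<close> below
  \<open>hm (T B) (\<eta> B b) (\<eta> B (F a))\<close>, while \<open>T F\<close> and naturality of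
  \<open>\<eta>\<close> map \<open>hm (T A) (\<eta> A a) t\<close> below
  \<open>hm (T B) (\<eta> B (F a)) (Tm A B F t)\<close>. These bounds compose in
  \<open>T B\<close>.\<close>

lemma Psh_map_N_le:
  assumes A: "A \<in> QCat Q U" and B: "B \<in> QCat Q U" and F: "qfunctor Q A B F" and t: "t \<in> ob (T A)"
  shows "obj_le Q (Psh Q B) (Psh_map Q A B F (N A t)) (N B (Tm A B F t))"
proof -
  note cA = QCat_qcategory[OF A] and cB = QCat_qcategory[OF B] and cTA = T_qcategory[OF A]
    and cTB = T_qcategory[OF B] and TF = Tm_functor[OF A B F]
  note PB = qcategory_Psh[OF cB] and YF = qfunctor_comp[OF cA cB qcategory_Psh[OF cB] F qfunctor_yoneda[OF cB]]
  note TFt = qfunctor_ob[OF TF t]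
  note Nt = qfunctor_ob[OF qfunctor_N[OF A] t] and NTFt = qfunctor_ob[OF qfunctor_N[OF B] TFt]
  have tyt: "ty (T B) (Tm A B F t) = ty (T A) t" using qfunctor_ty[OF TF t] .
  have "snd (Psh_map Q A B F (N A t)) b \<preceq> snd (N B (Tm A B F t)) b" if b: "b \<in> ob B" for b
    unfolding Psh_map_eq_wcolim
  proof (rule wcolim_least[OF cA cB YF Nt b])
    show "snd (N B (Tm A B F t)) b \<in> hom Q (fst (N A t)) (ty B b)"
      using Psh_homD[OF NTFt b _ refl] tyt by (simp add: nerve_def)
    fix a assume a: "a \<in> ob A"
    note Fa = qfunctor_ob[OF F a] and \<eta>b = qfunctor_ob[OF \<eta>_functor[OF B] b]
      and \<eta>a = qfunctor_ob[OF \<eta>_functor[OF A] a]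
    note \<eta>Fa = qfunctor_ob[OF \<eta>_functor[OF B] Fa] and TF\<eta>a = qfunctor_ob[OF TF \<eta>a]
    have tys: "ty (T B) (\<eta> B b) = ty B b" "ty (T B) (\<eta> B (F a)) = ty A a" "ty (T A) (\<eta> A a) = ty A a"
      "ty (T B) (Tm A B F (\<eta> A a)) = ty A a" "ty B (F a) = ty A a"
      using qfunctor_ty[OF \<eta>_functor[OF B]] qfunctor_ty[OF \<eta>_functor[OF A]] qfunctor_ty[OF TF]
        qfunctor_ty[OF F] a b Fa \<eta>a by simp_all
    have h1: "hm B b (F a) \<in> hom Q (ty A a) (ty B b)" "hm (T B) (\<eta> B b) (\<eta> B (F a)) \<in> hom Q (ty A a) (ty B b)"
      "hm (T A) (\<eta> A a) t \<in> hom Q (ty (T A) t) (ty A a)"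
      "hm (T B) (Tm A B F (\<eta> A a)) (Tm A B F t) \<in> hom Q (ty (T A) t) (ty A a)"
      "hm (T B) (\<eta> B (F a)) (Tm A B F t) \<in> hom Q (ty (T A) t) (ty A a)"
      "hm (T B) (\<eta> B b) (Tm A B F t) \<in> hom Q (ty (T A) t) (ty B b)"
      using Fa \<eta>b \<eta>a \<eta>Fa TF\<eta>a TFt t a b tys tyt
      by (auto intro!: qcategory_hom[OF cB] qcategory_hom[OF cTB] qcategory_hom[OF cTA])
    have "hm (T A) (\<eta> A a) t \<preceq> hm (T B) (\<eta> B (F a)) (Tm A B F t)"
      by (rule leq_trans[OF qfunctor_hm[OF TF t \<eta>a]
            hm_mono_left[OF cTB TFt \<eta>_natural_obj_le(1)[OF A B F a]] h1(3,4,5)])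
    then have "hm B b (F a) \<cdot> hm (T A) (\<eta> A a) t
        \<preceq> hm (T B) (\<eta> B b) (\<eta> B (F a)) \<cdot> hm (T B) (\<eta> B (F a)) (Tm A B F t)"
      by (intro cmp_mono[OF h1(3,5,1,2)] qfunctor_hm[OF \<eta>_functor[OF B] Fa b])
    then have "hm B b (F a) \<cdot> hm (T A) (\<eta> A a) t \<preceq> hm (T B) (\<eta> B b) (Tm A B F t)"
      by (rule leq_trans[OF _ qcategory_cmp[OF cTB TFt \<eta>Fa \<eta>b] cmp_hom[OF h1(3,1)]
            cmp_hom[OF h1(5,2)] h1(6)])
    then show "snd ((yoneda B \<circ> F) a) b \<cdot> snd (N A t) a \<preceq> snd (N B (Tm A B F t)) b"
      using a b by (simp add: nerve_def yoneda_def)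
  qed
  then show ?thesis
    using Psh_obj_le_iff[OF cB qfunctor_ob[OF qfunctor_Psh_map[OF cA cB F] Nt] NTFt] tyt
    by (simp add: Psh_map_def nerve_def)
qed

text \<open>By \<open>Psh_mult_Psh_map_le\<close> the left side lies below a colimit of
  \<open>N A\<close>. To bound its terms, apply \<open>\<mu> A\<close> to
  \<open>hm (T (T A)) (\<eta> (T A) t) s\<close>, identify \<open>\<mu> A (\<eta> (T A) t)\<close>
  with \<open>t\<close> by the unit law, and compose in \<open>T A\<close>.\<close>

lemma Psh_mult_N_le:
  assumes A: "A \<in> QCat Q U" and s: "s \<in> ob (T (T A))"
  shows "obj_le Q (Psh Q A) (Psh_mult Q A (Psh_map Q (T A) (Psh Q A) (N A) (N (T A) s))) (N A (\<mu> A s))"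
proof -
  note cA = QCat_qcategory[OF A] and cTA = T_qcategory[OF A] and TA = T_ob[OF A]
    and cTTA = T_qcategory[OF T_ob[OF A]] and NA = qfunctor_N[OF A]
    and \<eta>A = \<eta>_functor[OF A] and \<eta>TA = \<eta>_functor[OF T_ob[OF A]] and \<mu>A = \<mu>_functor[OF A]
  note \<mu>s = qfunctor_ob[OF \<mu>A s]
  note Ns = qfunctor_ob[OF qfunctor_N[OF TA] s] and N\<mu>s = qfunctor_ob[OF NA \<mu>s]
  have tys: "ty (T A) (\<mu> A s) = ty (T (T A)) s" using qfunctor_ty[OF \<mu>A s] .
  have "snd (wcolim Q (T A) A (N A) (N (T A) s)) a \<preceq> snd (N A (\<mu> A s)) a" if a: "a \<in> ob A" for a
  proof (rule wcolim_least[OF cTA cA NA Ns a])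
    show "snd (N A (\<mu> A s)) a \<in> hom Q (fst (N (T A) s)) (ty A a)"
      using Psh_homD[OF N\<mu>s a _ refl] tys by (simp add: nerve_def)
    fix t assume t: "t \<in> ob (T A)"
    note \<eta>a = qfunctor_ob[OF \<eta>A a] and \<eta>t = qfunctor_ob[OF \<eta>TA t]
    note \<mu>\<eta>t = qfunctor_ob[OF \<mu>A \<eta>t]
    have ty: "ty (T A) (\<eta> A a) = ty A a" "ty (T (T A)) (\<eta> (T A) t) = ty (T A) t"
      "ty (T A) (\<mu> A (\<eta> (T A) t)) = ty (T A) t"
      using qfunctor_ty[OF \<eta>A] qfunctor_ty[OF \<eta>TA] qfunctor_ty[OF \<mu>A] a t \<eta>t by simp_all
    have h: "hm (T A) (\<eta> A a) t \<in> hom Q (ty (T A) t) (ty A a)"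
      "hm (T (T A)) (\<eta> (T A) t) s \<in> hom Q (ty (T (T A)) s) (ty (T A) t)"
      "hm (T A) (\<mu> A (\<eta> (T A) t)) (\<mu> A s) \<in> hom Q (ty (T (T A)) s) (ty (T A) t)"
      "hm (T A) t (\<mu> A s) \<in> hom Q (ty (T (T A)) s) (ty (T A) t)"
      "hm (T A) (\<eta> A a) (\<mu> A s) \<in> hom Q (ty (T (T A)) s) (ty A a)"
      using \<eta>a \<eta>t \<mu>\<eta>t \<mu>s t s ty tys by (auto intro!: qcategory_hom[OF cTA] qcategory_hom[OF cTTA])
    have "hm (T (T A)) (\<eta> (T A) t) s \<preceq> hm (T A) t (\<mu> A s)"
      by (rule leq_trans[OF qfunctor_hm[OF \<mu>A s \<eta>t] hm_mono_left[OF cTA \<mu>s \<mu>_\<eta>_obj_le[OF A t]] h(2,3,4)])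
    then have "hm (T A) (\<eta> A a) t \<cdot> hm (T (T A)) (\<eta> (T A) t) s \<preceq> hm (T A) (\<eta> A a) t \<cdot> hm (T A) t (\<mu> A s)"
      by (rule cmp_mono_right[OF h(2,4,1)])
    then have "hm (T A) (\<eta> A a) t \<cdot> hm (T (T A)) (\<eta> (T A) t) s \<preceq> hm (T A) (\<eta> A a) (\<mu> A s)"
      by (rule leq_trans[OF _ qcategory_cmp[OF cTA \<mu>s t \<eta>a] cmp_hom[OF h(2,1)] cmp_hom[OF h(4,1)] h(5)])
    then show "snd (N A t) a \<cdot> snd (N (T A) s) t \<preceq> snd (N A (\<mu> A s)) a"
      using a t by (simp add: nerve_def)
  qed
  then have "obj_le Q (Psh Q A) (wcolim Q (T A) A (N A) (N (T A) s)) (N A (\<mu> A s))"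
    using Psh_obj_le_iff[OF cA wcolim_ob[OF cTA cA NA Ns] N\<mu>s] tys
    by (simp add: wcolim_def nerve_def)
  then show ?thesis
    using Psh_mult_Psh_map_le[OF cTA cA NA Ns] obj_le_trans[OF qcategory_Psh[OF cA]] by blast
qed

section \<open>The reverse inequalities for fully faithful units\<close>

context
  assumes U: "universe U" and Q: "small_quantaloid U Q"
    and \<eta>_ff: "\<And>A. A \<in> QCat Q U \<Longrightarrow> fully_faithful Q A (T A) (\<eta> A)"
begin

lemma N_\<eta>: "A \<in> QCat Q U \<Longrightarrow> a \<in> ob A \<Longrightarrow> N A (\<eta> A a) = yoneda A a"
  using fully_faithful_hm[OF \<eta>_ff] qfunctor_ty[OF \<eta>_functor]
  by (auto simp: nerve_def yoneda_def fun_eq_iff restrict_def)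

lemma Psh_retraction:
  assumes B: "B \<in> QCat Q U"
  obtains X g h \<alpha> where "X \<in> QCat Q U" "qfunctor Q X (Psh Q B) g" "qfunctor Q (Psh Q B) X h"
    "\<And>\<phi>. \<phi> \<in> ob (Psh Q B) \<Longrightarrow> g (h \<phi>) = \<phi>"
    "qfunctor Q (T X) X \<alpha>" "\<And>x. x \<in> ob X \<Longrightarrow> \<alpha> (\<eta> X x) = x"
proof -
  note cB = QCat_qcategory[OF B] and PB = qcategory_Psh[OF QCat_qcategory[OF B]]
  obtain X :: "('u, 'o, 'm) qcat" and g h where X: "X \<in> QCat Q U" and g: "qfunctor Q X (Psh Q B) g"
    and h: "qfunctor Q (Psh Q B) X h" and hg: "\<And>x. x \<in> ob X \<Longrightarrow> h (g x) = x"
    and gh: "\<And>\<phi>. \<phi> \<in> ob (Psh Q B) \<Longrightarrow> g (h \<phi>) = \<phi>"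
    using small_copy[OF PB small_Psh[OF U Q B]] by blast
  note cX = QCat_qcategory[OF X] and cTX = T_qcategory[OF X]
  \<comment> \<open>\<open>N X\<close> turns an object of \<open>T X\<close> into a weight on
    \<open>X\<close>, the colimit of \<open>g\<close> with this weight is a presheaf on
    \<open>B\<close>, and \<open>h\<close> sends it back to the small copy.\<close>
  define \<alpha> where "\<alpha> = h \<circ> (wcolim Q X B g \<circ> N X)"
  have "qfunctor Q (T X) X \<alpha>" unfolding \<alpha>_def
    by (rule qfunctor_comp[OF cTX PB cX qfunctor_comp[OF cTX qcategory_Psh[OF cX] PB qfunctor_N[OF X]
            qfunctor_wcolim[OF cX cB g]] h])
  \<comment> \<open>Full faithfulness of \<open>\<eta> X\<close> enters here: the weight of
    \<open>\<eta> X x\<close> is representable, so the colimit is \<open>g x\<close>.\<close>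
  moreover have "\<alpha> (\<eta> X x) = x" if "x \<in> ob X" for x
    using that by (simp add: \<alpha>_def N_\<eta>[OF X] wcolim_yoneda[OF cX cB g] hg)
  ultimately show thesis using that X g h gh by blast
qed

text \<open>The right side, as a functor of \<open>t\<close>, extends the Yoneda embedding along
  \<open>\<eta> B\<close>: naturality moves \<open>\<eta>\<close> past
  \<open>T (h \<circ> yoneda B)\<close>, \<open>\<alpha>\<close> removes it, and \<open>g\<close>
  undoes \<open>h\<close>. Minimality of the Kan extension \<open>N B\<close> then gives the
  bound.\<close>

lemma N_le_extension:
  assumes B: "B \<in> QCat Q U" and X: "X \<in> QCat Q U" and g: "qfunctor Q X (Psh Q B) g"
    and h: "qfunctor Q (Psh Q B) X h" and gh: "\<And>\<phi>. \<phi> \<in> ob (Psh Q B) \<Longrightarrow> g (h \<phi>) = \<phi>"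
    and \<alpha>: "qfunctor Q (T X) X \<alpha>" and \<alpha>_\<eta>: "\<And>x. x \<in> ob X \<Longrightarrow> \<alpha> (\<eta> X x) = x"
    and t: "t \<in> ob (T B)"
  shows "obj_le Q (Psh Q B) (N B t) (g (\<alpha> (Tm B X (h \<circ> yoneda B) t)))"
proof -
  note cB = QCat_qcategory[OF B] and cX = QCat_qcategory[OF X] and cTX = T_qcategory[OF X]
    and cTB = T_qcategory[OF B] and \<eta>B = \<eta>_functor[OF B]
  note PB = qcategory_Psh[OF cB] and Y = qfunctor_yoneda[OF cB]
  note H = qfunctor_comp[OF cB PB cX Y h]
  define K where "K = g \<circ> (\<alpha> \<circ> Tm B X (h \<circ> yoneda B))"
  have K: "qfunctor Q (T B) (Psh Q B) K" unfolding K_def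
    by (rule qfunctor_comp[OF cTB cX PB qfunctor_comp[OF cTB cTX cX Tm_functor[OF B X H] \<alpha>] g])
  have "obj_le Q (Psh Q B) (yoneda B b) ((K \<circ> \<eta> B) b)" if b: "b \<in> ob B" for b
  proof -
    note Yb = qfunctor_ob[OF Y b]
    have "obj_le Q X (\<alpha> (\<eta> X (h (yoneda B b)))) (\<alpha> (Tm B X (h \<circ> yoneda B) (\<eta> B b)))"
      using qfunctor_obj_le[OF cTX cX \<alpha> \<eta>_natural_obj_le(1)[OF B X H b]] by simp
    then have "obj_le Q X (h (yoneda B b)) (\<alpha> (Tm B X (h \<circ> yoneda B) (\<eta> B b)))"
      using \<alpha>_\<eta>[OF qfunctor_ob[OF h Yb]] by simp
    then show ?thesis
      using qfunctor_obj_le[OF cX PB g] gh[OF Yb] by (fastforce simp: K_def)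
  qed
  then have "fun_le Q B (Psh Q B) (yoneda B) (K \<circ> \<eta> B)"
    using fun_le_iff[OF cB PB Y qfunctor_comp[OF cB cTB PB \<eta>B K]] by blast
  then have "fun_le Q (T B) (Psh Q B) (N B) K"
    using is_lan_nerve[OF cB cTB \<eta>B] K by (auto simp: is_lan_def)
  then show ?thesis using fun_le_obj_le[OF _ cTB PB qfunctor_N[OF B] K t] by (simp add: K_def)
qed

text \<open>In the bound of \<open>N_le_extension\<close>, functoriality of \<open>T\<close> absorbs
  \<open>F\<close>. Since \<open>h \<circ> Psh_map Q A B F \<circ> N A\<close> restricts along
  \<open>\<eta> A\<close> to \<open>h \<circ> yoneda B \<circ> F\<close>, leastness of the algebra
  extension finishes the comparison.\<close>

lemma N_le_Psh_map:
  assumes A: "A \<in> QCat Q U" and B: "B \<in> QCat Q U" and F: "qfunctor Q A B F" and t: "t \<in> ob (T A)"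
  shows "obj_le Q (Psh Q B) (N B (Tm A B F t)) (Psh_map Q A B F (N A t))"
proof -
  obtain X g h \<alpha> where X: "X \<in> QCat Q U" and g: "qfunctor Q X (Psh Q B) g"
    and h: "qfunctor Q (Psh Q B) X h" and gh: "\<And>\<phi>. \<phi> \<in> ob (Psh Q B) \<Longrightarrow> g (h \<phi>) = \<phi>"
    and \<alpha>: "qfunctor Q (T X) X \<alpha>" and \<alpha>_\<eta>: "\<And>x. x \<in> ob X \<Longrightarrow> \<alpha> (\<eta> X x) = x"
    using Psh_retraction[OF B] by metis
  note cA = QCat_qcategory[OF A] and cB = QCat_qcategory[OF B] and cX = QCat_qcategory[OF X]
    and cTX = T_qcategory[OF X] and cTA = T_qcategory[OF A] and NA = qfunctor_N[OF A]
  note PA = qcategory_Psh[OF cA] and PB = qcategory_Psh[OF cB] and Y = qfunctor_yoneda[OF cB]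
    and PF = qfunctor_Psh_map[OF cA cB F]
  note H = qfunctor_comp[OF cB PB cX Y h]
  note HF = qfunctor_comp[OF cA cB cX F H]
  note K = qfunctor_comp[OF cTA PB cX qfunctor_comp[OF cTA PA PB NA PF] h]
  note TFt = qfunctor_ob[OF Tm_functor[OF A B F] t]
  have 1: "obj_le Q (Psh Q B) (N B (Tm A B F t)) (g (\<alpha> (Tm B X (h \<circ> yoneda B) (Tm A B F t))))"
    by (rule N_le_extension[OF B X g h gh \<alpha> \<alpha>_\<eta> TFt])
  have 2: "obj_le Q X (\<alpha> (Tm B X (h \<circ> yoneda B) (Tm A B F t))) (\<alpha> (Tm A X (h \<circ> yoneda B \<circ> F) t))"
    by (rule qfunctor_obj_le[OF cTX cX \<alpha> Tm_comp_obj_le(2)[OF A B X F H t]])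
  have 3: "obj_le Q X (\<alpha> (Tm A X (h \<circ> yoneda B \<circ> F) t)) ((h \<circ> (Psh_map Q A B F \<circ> N A)) t)"
  proof (rule retraction_extension_least[OF X \<alpha> \<alpha>_\<eta> A HF K _ t])
    fix a assume a: "a \<in> ob A"
    show "obj_le Q X ((h \<circ> yoneda B \<circ> F) a) ((h \<circ> (Psh_map Q A B F \<circ> N A)) (\<eta> A a))"
      using obj_le_refl[OF cX qfunctor_ob[OF HF a]] a
      by (simp add: N_\<eta>[OF A] Psh_map_yoneda[OF cA cB F])
  qed
  have "obj_le Q (Psh Q B) (N B (Tm A B F t)) (g ((h \<circ> (Psh_map Q A B F \<circ> N A)) t))"
    using obj_le_trans[OF PB 1 qfunctor_obj_le[OF cX PB g obj_le_trans[OF cX 2 3]]] .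
  then show ?thesis using gh[OF qfunctor_ob[OF PF qfunctor_ob[OF NA t]]] by simp
qed

text \<open>The bound of \<open>N_le_extension\<close> contains \<open>\<mu> A\<close>; naturality
  moves it to \<open>\<mu> X\<close>, and \<open>retraction_mult\<close> trades it for
  \<open>T \<alpha>\<close>. What remains is an algebra extension along \<open>\<eta> (T A)\<close>,
  to which leastness applies.\<close>

lemma N_le_Psh_mult:
  assumes A: "A \<in> QCat Q U" and s: "s \<in> ob (T (T A))"
  shows "obj_le Q (Psh Q A) (N A (\<mu> A s)) (Psh_mult Q A (Psh_map Q (T A) (Psh Q A) (N A) (N (T A) s)))"
proof -
  obtain X g h \<alpha> where X: "X \<in> QCat Q U" and g: "qfunctor Q X (Psh Q A) g"
    and h: "qfunctor Q (Psh Q A) X h" and gh: "\<And>\<phi>. \<phi> \<in> ob (Psh Q A) \<Longrightarrow> g (h \<phi>) = \<phi>"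
    and \<alpha>: "qfunctor Q (T X) X \<alpha>" and \<alpha>_\<eta>: "\<And>x. x \<in> ob X \<Longrightarrow> \<alpha> (\<eta> X x) = x"
    using Psh_retraction[OF A] by metis
  note cA = QCat_qcategory[OF A] and cX = QCat_qcategory[OF X] and TA = T_ob[OF A] and TX = T_ob[OF X]
    and cTX = T_qcategory[OF X] and cTA = T_qcategory[OF A] and NA = qfunctor_N[OF A]
    and cTTA = T_qcategory[OF T_ob[OF A]]
  note PA = qcategory_Psh[OF cA] and Y = qfunctor_yoneda[OF cA]
  note PPA = qcategory_Psh[OF PA] and PTA = qcategory_Psh[OF cTA] and M = qfunctor_Psh_mult[OF cA]
    and PN = qfunctor_Psh_map[OF cTA PA NA]
  note H = qfunctor_comp[OF cA PA cX Y h]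
  note TH = Tm_functor[OF A X H]
  note \<alpha>TH = qfunctor_comp[OF cTA cTX cX TH \<alpha>]
  note MPN = qfunctor_comp[OF cTTA PPA PA qfunctor_comp[OF cTTA PTA PPA qfunctor_N[OF TA] PN] M]
  define K where "K = h \<circ> (Psh_mult Q A \<circ> (Psh_map Q (T A) (Psh Q A) (N A) \<circ> N (T A)))"
  have K: "qfunctor Q (T (T A)) X K" unfolding K_def by (rule qfunctor_comp[OF cTTA PA cX MPN h])
  note TTHs = qfunctor_ob[OF Tm_functor[OF TA TX TH] s]
  have 1: "obj_le Q (Psh Q A) (N A (\<mu> A s)) (g (\<alpha> (Tm A X (h \<circ> yoneda A) (\<mu> A s))))"
    by (rule N_le_extension[OF A X g h gh \<alpha> \<alpha>_\<eta> qfunctor_ob[OF \<mu>_functor[OF A] s]])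
  have "obj_le Q X (\<alpha> (Tm A X (h \<circ> yoneda A) (\<mu> A s)))
      (\<alpha> (\<mu> X (Tm (T A) (T X) (Tm A X (h \<circ> yoneda A)) s)))"
    by (rule qfunctor_obj_le[OF cTX cX \<alpha> \<mu>_natural_obj_le[OF A X H s]])
  also have "obj_le Q X (\<alpha> (\<mu> X (Tm (T A) (T X) (Tm A X (h \<circ> yoneda A)) s)))
      (\<alpha> (Tm (T X) X \<alpha> (Tm (T A) (T X) (Tm A X (h \<circ> yoneda A)) s)))"
    by (rule retraction_mult[OF X \<alpha> \<alpha>_\<eta> TTHs])
  also (obj_le_trans[OF cX]) have "obj_le Q X (\<alpha> (Tm (T X) X \<alpha> (Tm (T A) (T X) (Tm A X (h \<circ> yoneda A)) s)))
      (\<alpha> (Tm (T A) X (\<alpha> \<circ> Tm A X (h \<circ> yoneda A)) s))"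
    by (rule qfunctor_obj_le[OF cTX cX \<alpha> Tm_comp_obj_le(2)[OF TA TX X TH \<alpha> s]])
  also (obj_le_trans[OF cX]) have "obj_le Q X (\<alpha> (Tm (T A) X (\<alpha> \<circ> Tm A X (h \<circ> yoneda A)) s)) (K s)"
  proof (rule retraction_extension_least[OF X \<alpha> \<alpha>_\<eta> TA \<alpha>TH K _ s])
    fix t assume t: "t \<in> ob (T A)"
    \<comment> \<open>Leastness once more, one level lower: \<open>h \<circ> N A\<close> restricts
      along \<open>\<eta> A\<close> to \<open>h \<circ> yoneda A\<close>.\<close>
    have "obj_le Q X (\<alpha> (Tm A X (h \<circ> yoneda A) t)) ((h \<circ> N A) t)"
    proof (rule retraction_extension_least[OF X \<alpha> \<alpha>_\<eta> A H qfunctor_comp[OF cTA PA cX NA h] _ t])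
      show "obj_le Q X ((h \<circ> yoneda A) a) ((h \<circ> N A) (\<eta> A a))" if a: "a \<in> ob A" for a
        using obj_le_refl[OF cX qfunctor_ob[OF H a]] by (simp add: N_\<eta>[OF A a])
    qed
    \<comment> \<open>On the unit all weights involved are representable, so \<open>Psh_map\<close>
      and \<open>Psh_mult\<close> collapse to the value \<open>N A t\<close>.\<close>
    moreover have "K (\<eta> (T A) t) = h (N A t)"
      by (simp add: K_def N_\<eta>[OF TA t] Psh_map_yoneda[OF cTA PA NA t]
          Psh_mult_yoneda[OF cA qfunctor_ob[OF NA t]])
    ultimately show "obj_le Q X ((\<alpha> \<circ> Tm A X (h \<circ> yoneda A)) t) (K (\<eta> (T A) t))" by simp
  qed
  finally (obj_le_trans[OF cX]) have "obj_le Q (Psh Q A) (N A (\<mu> A s)) (g (K s))"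
    using obj_le_trans[OF PA 1 qfunctor_obj_le[OF cX PA g]] by blast
  then show ?thesis using gh[OF qfunctor_ob[OF MPN s]] by (simp add: K_def)
qed

end

section \<open>The characterization by nerves and by Kan extensions\<close>

lemma full_sub_KZ_doctrine_iff_nerve:
  assumes U: "universe U" and Q: "small_quantaloid U Q"
  shows "full_sub_KZ_doctrine Q U T Tm \<mu> \<eta> \<longleftrightarrow>
    (\<forall>A\<in>QCat Q U. fully_faithful Q A (T A) (\<eta> A) \<and> fully_faithful Q (T A) (Psh Q A) (N A))"
proof
  assume "full_sub_KZ_doctrine Q U T Tm \<mu> \<eta>"
  then obtain \<epsilon> where \<epsilon>: "\<And>A. A \<in> QCat Q U \<Longrightarrow> fully_faithful Q (T A) (Psh Q A) (\<epsilon> A)"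
    and iso: "\<And>A. A \<in> QCat Q U \<Longrightarrow> fun_iso Q A (Psh Q A) (yoneda A) (\<epsilon> A \<circ> \<eta> A)"
    unfolding full_sub_KZ_doctrine_def by blast
  show "\<forall>A\<in>QCat Q U. fully_faithful Q A (T A) (\<eta> A) \<and> fully_faithful Q (T A) (Psh Q A) (N A)"
  proof (intro ballI conjI)
    fix A assume A: "A \<in> QCat Q U"
    note cA = QCat_qcategory[OF A] and cTA = T_qcategory[OF A] and \<eta>A = \<eta>_functor[OF A]
      and \<epsilon>A = fully_faithful_qfunctor[OF \<epsilon>[OF A]]
    note PA = qcategory_Psh[OF cA]
    \<comment> \<open>The composite is isomorphic to the Yoneda embedding; cancelling the fully
      faithful \<open>\<epsilon> A\<close> passes full faithfulness on to
      \<open>\<eta> A\<close>.\<close>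
    have "fully_faithful Q A (Psh Q A) (\<epsilon> A \<circ> \<eta> A)"
      by (rule fully_faithful_cong[OF cA PA qfunctor_comp[OF cA cTA PA \<eta>A \<epsilon>A] iso[OF A]
            fully_faithful_yoneda[OF cA]])
    then show "fully_faithful Q A (T A) (\<eta> A)"
      using \<eta>A fully_faithful_hm[OF \<epsilon>[OF A]] qfunctor_ob[OF \<eta>A] by (simp add: fully_faithful_def)
    have "\<epsilon> A t = N A t" if "t \<in> ob (T A)" for t
      by (rule extension_eq_nerve[OF cA cTA \<eta>A \<epsilon>[OF A] iso[OF A] that])
    then show "fully_faithful Q (T A) (Psh Q A) (N A)"
      using \<epsilon>[OF A] qfunctor_N[OF A] by (simp add: fully_faithful_def)
  qed
next
  assume ff: "\<forall>A\<in>QCat Q U. fully_faithful Q A (T A) (\<eta> A) \<and> fully_faithful Q (T A) (Psh Q A) (N A)"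
  then have \<eta>_ff: "\<And>A. A \<in> QCat Q U \<Longrightarrow> fully_faithful Q A (T A) (\<eta> A)" by blast
  show "full_sub_KZ_doctrine Q U T Tm \<mu> \<eta>"
    unfolding full_sub_KZ_doctrine_def
  \<comment> \<open>By the first direction the nerve is the only possible choice for
    \<open>\<epsilon>\<close>, up to irrelevant values.\<close>
  proof (intro exI[of _ N] conjI ballI allI impI)
    fix A assume A: "A \<in> QCat Q U"
    note cA = QCat_qcategory[OF A] and cTA = T_qcategory[OF A] and \<eta>A = \<eta>_functor[OF A]
      and NA = qfunctor_N[OF A] and TA = T_ob[OF A] and cTTA = T_qcategory[OF T_ob[OF A]]
    note PA = qcategory_Psh[OF cA] and PTA = qcategory_Psh[OF cTA]
    note PPA = qcategory_Psh[OF PA]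
    show "fully_faithful Q (T A) (Psh Q A) (N A)" using ff A by blast
    show "fun_iso Q A (Psh Q A) (yoneda A) (N A \<circ> \<eta> A)"
      using N_\<eta>[OF U Q \<eta>_ff A] obj_le_refl[OF PA qfunctor_ob[OF qfunctor_yoneda[OF cA]]]
        fun_le_iff[OF cA PA] qfunctor_yoneda[OF cA] qfunctor_comp[OF cA cTA PA \<eta>A NA]
      by (simp add: fun_iso_def)
    note MPN = qfunctor_comp[OF cTTA PPA PA qfunctor_comp[OF cTTA PTA PPA qfunctor_N[OF TA]
          qfunctor_Psh_map[OF cTA PA NA]] qfunctor_Psh_mult[OF cA]]
      and N\<mu> = qfunctor_comp[OF cTTA cTA PA \<mu>_functor[OF A] NA]
    show "fun_iso Q (T (T A)) (Psh Q A)
        (Psh_mult Q A \<circ> (Psh_map Q (T A) (Psh Q A) (N A) \<circ> N (T A))) (N A \<circ> \<mu> A)"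
      using Psh_mult_N_le[OF A] N_le_Psh_mult[OF U Q \<eta>_ff A]
      by (simp add: fun_iso_def fun_le_iff[OF cTTA PA MPN N\<mu>] fun_le_iff[OF cTTA PA N\<mu> MPN])
    fix B F assume B: "B \<in> QCat Q U" and F: "qfunctor Q A B F"
    note cB = QCat_qcategory[OF B] and cTB = T_qcategory[OF B]
    note PB = qcategory_Psh[OF cB]
    note NT = qfunctor_comp[OF cTA cTB PB Tm_functor[OF A B F] qfunctor_N[OF B]]
      and PN = qfunctor_comp[OF cTA PA PB NA qfunctor_Psh_map[OF cA cB F]]
    show "fun_iso Q (T A) (Psh Q B) (N B \<circ> Tm A B F) (Psh_map Q A B F \<circ> N A)"
      using Psh_map_N_le[OF A B F] N_le_Psh_map[OF U Q \<eta>_ff A B F]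
      by (simp add: fun_iso_def fun_le_iff[OF cTA PB NT PN] fun_le_iff[OF cTA PB PN NT])
  qed
qed

end

theorem corollary2p5:
  fixes Q :: "('o, 'm) quantaloid"
    and U :: "'u set set"
    and T :: "('u, 'o, 'm) qcat \<Rightarrow> ('u, 'o, 'm) qcat"
    and Tm :: "('u, 'o, 'm) qcat \<Rightarrow> ('u, 'o, 'm) qcat \<Rightarrow> ('u \<Rightarrow> 'u) \<Rightarrow> 'u \<Rightarrow> 'u"
    and \<mu> \<eta> :: "('u, 'o, 'm) qcat \<Rightarrow> 'u \<Rightarrow> 'u"
  assumes "universe U"
    and "small_quantaloid U Q"
    and "KZ_doctrine Q U T Tm \<mu> \<eta>"
  shows "full_sub_KZ_doctrine Q U T Tm \<mu> \<eta> \<longleftrightarrow>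
    (\<forall>A\<in>QCat Q U.
       fully_faithful Q A (T A) (\<eta> A) \<and>
       (\<exists>K. is_lan Q A (Psh Q A) (T A) (yoneda A) (\<eta> A) K \<and>
            fully_faithful Q (T A) (Psh Q A) K))"
proof -
  interpret quantaloid_KZ_doctrine Q U T Tm \<mu> \<eta>
    using assms by (simp add: quantaloid_KZ_doctrine_def small_quantaloid_def)
  \<comment> \<open>Kan extensions are unique up to \<open>fun_iso\<close>, which preserves full
    faithfulness, so the existential can be tested on the nerve.\<close>
  have "(\<exists>K. is_lan Q A (Psh Q A) (T A) (yoneda A) (\<eta> A) K \<and> fully_faithful Q (T A) (Psh Q A) K)
      \<longleftrightarrow> fully_faithful Q (T A) (Psh Q A) (N A)" (is "?L \<longleftrightarrow> ?R") if A: "A \<in> QCat Q U" for A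
  proof
    note cA = QCat_qcategory[OF A] and cTA = T_qcategory[OF A]
    note lan = is_lan_nerve[OF cA cTA \<eta>_functor[OF A]]
    show ?L if ?R using that lan by blast
    assume ?L
    then obtain K where K: "is_lan Q A (Psh Q A) (T A) (yoneda A) (\<eta> A) K"
      and ff: "fully_faithful Q (T A) (Psh Q A) K" by blast
    have "fun_iso Q (T A) (Psh Q A) K (N A)"
      using K lan unfolding is_lan_def fun_iso_def by blast
    then show ?R by (rule fully_faithful_cong[OF cTA qcategory_Psh[OF cA] qfunctor_N[OF A] _ ff])
  qed
  then show ?thesis using full_sub_KZ_doctrine_iff_nerve[OF assms(1,2)] by simp
qed

end
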